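(* For $n\ge1$ let $J_n=\{\{1\},\ldots,\{n\}\}$. The sequence $((n-1)!\,\lambda_{\mathcal{NCP}}(J_n))_{n\ge1}$ is, up to signs, the sequence of coefficients of the infinitesimal generator of $X(1+X)$; that is, if $v(X)=\sum_{n\ge1}v_nX^{n+1}$ denotes the infinitesimal generator of $X(1+X)$, then $(n-1)!\,\lambda_{\mathcal{NCP}}(J_n)=\pm(n-1)!\,v_n$ for every $n\ge1$. Moreover, $$\forall n\ge2,\qquad\lambda_{\mathcal{NCP}}(J_n)=-\frac{1}{n-1}\sum_{i=1}^{\lfloor n/2\rfloor}\binom{n-i+1}{i+1}\lambda_{\mathcal{NCP}}(J_{n-i}).$$
   Context: $\mathbb{K}$ is a field of characteristic zero. The infinitesimal generator of $X(1+X)=X+X^2$ is the unique formal series $v(X)\in X^2\mathbb{K}[[X]]$ such that $\sum_{k\ge0}\frac{1}{k!}\left(v(X)\frac{d}{dX}\right)^k(X)=X+X^2$. A noncrossing partition is a partition $\pi$ of a set $[n]=\{1,\ldots,n\}$, $n\ge1$, into nonempty blocks such that there are no distinct blocks $b\ne b'$ and $x,z\in b$, $y,t\in b'$ with $x<y<z<t$. $|\pi|$ is its number of blocks; $\mathcal{NCP}$ is the set of all noncrossing partitions. For a nonempty set $Y$ of blocks of $\pi$, $\pi_{\mid Y}$ is the noncrossing partition obtained by deleting the blocks not in $Y$ and renumbering the remaining elements increasingly. The nesting order on blocks is $b\le_\pi b'\iff b'\subseteq[\min b,\max b]$. $\mathrm{le}(\pi)$ is the number of bijections $f:\pi\to[|\pi|]$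 with $b\le_\pi b'\Rightarrow f(b)\le f(b')$. $\mathbb{K}[\mathcal{NCP}]$ is the free commutative algebra generated by $\mathcal{NCP}$, with product $\cdot$. It has a coproduct $\delta$, an algebra morphism given on $\pi\in\mathcal{NCP}$ by $\delta(\pi)=\sum_{\sim\in\mathcal{E}_c[\pi]}\pi/\!\sim\,\otimes\,\pi\mid_\cdot\sim$, where, for an equivalence $\sim$ on the set of blocks of $\pi$, $\pi/\!\sim$ is the partition whose blocks are the unions of the blocks in each class, $\mathcal{E}_c[\pi]$ is the set of $\sim$ for which $\pi/\!\sim$ is noncrossing, and $\pi\mid_\cdot\sim=\prod_{C\text{ class of }\sim}\pi_{\mid C}$. Its counit is the character with $\epsilon_\delta(\pi)=1$ if $|\pi|=1$ and $0$ otherwise. Characters of $\mathbb{K}[\mathcal{NCP}]$ (algebra morphisms to $\mathbb{K}$) form a monoid under $\lambda\star\mu=(\lambda\otimes\mu)\circ\delta$, with unit $\epsilon_\delta$. $\lambda_0$ is the character with $\lambda_0(\pi)=\mathrm{le}(\pi)/|\pi|!$ for $\pi\in\mathcal{NCP}$; it is invertible for $\star$ and $\lambda_{\mathcal{NCP}}$ is its inverse. Known: $\lambda_{\mathcal{NCP}}(J_n)$ is the coefficient of $X$ in the polynomial $P_n$, where $(P_n)_{n\ge0}$ is the unique sequence of polynomials with $P_0=1$ and, for $k\ge1$, $P_k(0)=0$ and $P_k(X+1)=P_k(X)+\sum_{i=1}^kP_{i-1}(X)P_{k-i}(X)$. *)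

theory Defs
  imports
    Complex_Main
    "HOL-Library.FuncSet"
    "HOL-Library.Disjoint_Sets"
    "HOL-Library.Poly_Mapping"
    "HOL-Library.Product_Plus"
    "HOL-Computational_Algebra.Formal_Power_Series"
begin

section \<open>Noncrossing partitions\<close>

definition noncrossing :: "nat set set \<Rightarrow> bool" where
  "noncrossing P \<longleftrightarrow>
     (\<forall>b\<in>P. \<forall>b'\<in>P. b \<noteq> b' \<longrightarrow>
        \<not> (\<exists>x\<in>b. \<exists>y\<in>b'. \<exists>z\<in>b. \<exists>t\<in>b'. x < y \<and> y < z \<and> z < t))"

definition NCP :: "nat set set set" where
  "NCP = {P. noncrossing P \<and> (\<exists>n\<ge>1. partition_on {1..n} P)}"

definition rank_in :: "nat set \<Rightarrow> nat \<Rightarrow> nat" where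
  "rank_in S x = card {y\<in>S. y \<le> x}"

text \<open>Deleting the blocks outside \<open>Y\<close> and renumbering increasingly.\<close>

definition std_blocks :: "nat set set \<Rightarrow> nat set set" where
  "std_blocks Y = (\<lambda>b. rank_in (\<Union>Y) ` b) ` Y"

definition singletons :: "nat \<Rightarrow> nat set set" where
  "singletons n = (\<lambda>i. {i}) ` {1..n}"

lemma singletons_NCP: "1 \<le> n \<Longrightarrow> singletons n \<in> NCP"
  by (auto simp: singletons_def NCP_def noncrossing_def partition_on_def disjoint_def)

typedef ncp = NCP
  morphisms blocks Abs_ncp
  using singletons_NCP[of 1] by blast

lemma rank_in_strict_mono:
  assumes "finite S" "x \<in> S" "y \<in> S"
  shows "rank_in S x < rank_in S y \<longleftrightarrow> x < y"
proof -
  have *: "rank_in S x < rank_in S y" if "x < y" "y \<in> S" for x y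
  proof -
    have "y \<in> {z\<in>S. z \<le> y}" "y \<notin> {z\<in>S. z \<le> x}" using that by simp_all
    moreover have "{z\<in>S. z \<le> x} \<subseteq> {z\<in>S. z \<le> y}" using that(1) by (simp add: Collect_mono)
    ultimately have "{z\<in>S. z \<le> x} \<subset> {z\<in>S. z \<le> y}" by (metis psubsetI)
    then show ?thesis unfolding rank_in_def by (rule psubset_card_mono[rotated]) (simp add: assms(1))
  qed
  show ?thesis
    using *[of x y] *[of y x] assms(2,3) by (cases x y rule: linorder_cases) simp_all
qed

lemma rank_in_inj: "finite S \<Longrightarrow> inj_on (rank_in S) S"
proof (rule inj_onI)
  fix x y assume "finite S" "x \<in> S" "y \<in> S" "rank_in S x = rank_in S y"
  then show "x = y"
    using rank_in_strict_mono[of S x y] rank_in_strict_mono[of S y x] by simp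
qed

lemma rank_in_image:
  assumes "finite S"
  shows "rank_in S ` S = {1..card S}"
proof (rule card_subset_eq)
  show "rank_in S ` S \<subseteq> {1..card S}"
  proof
    fix k assume "k \<in> rank_in S ` S"
    then obtain x where x: "x \<in> S" "k = card {y\<in>S. y \<le> x}" by (auto simp: rank_in_def)
    have "{y\<in>S. y \<le> x} \<noteq> {}" using x by auto
    then have "1 \<le> k" using x assms by (simp add: Suc_le_eq card_gt_0_iff)
    moreover have "k \<le> card S" using x assms by (auto intro: card_mono)
    ultimately show "k \<in> {1..card S}" by simp
  qed
  show "card (rank_in S ` S) = card {1..card S}"
    using rank_in_inj[OF assms] by (simp add: card_image)
qed simp

lemma std_blocks_NCP:
  assumes P: "P \<in> NCP" and Y: "Y \<subseteq> P" "Y \<noteq> {}"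
  shows "std_blocks Y \<in> NCP"
proof -
  define S where "S = \<Union>Y"
  obtain n where n: "partition_on {1..n} P" and nc: "noncrossing P"
    using P by (auto simp: NCP_def)
  have "S \<subseteq> {1..n}" using n Y by (auto simp: S_def partition_on_def)
  then have fin: "finite S" by (rule finite_subset) simp
  have sub: "b \<subseteq> S" if "b \<in> Y" for b using that by (auto simp: S_def)
  have inj: "inj_on (rank_in S) S" by (rule rank_in_inj[OF fin])
  have ne: "{} \<notin> Y" using n Y by (auto simp: partition_on_def)
  have "S \<noteq> {}" using Y ne by (auto simp: S_def)
  then have card: "1 \<le> card S" using fin by (simp add: Suc_le_eq card_gt_0_iff)
  have eq: "std_blocks Y = (\<lambda>b. rank_in S ` b) ` Y" by (simp add: std_blocks_def S_def)
  have "\<Union>(std_blocks Y) = rank_in S ` S" by (auto simp: eq S_def)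
  then have un: "\<Union>(std_blocks Y) = {1..card S}" using rank_in_image[OF fin] by simp
  have "disjoint Y"
    using n Y by (meson pairwise_subset partition_onD2)
  have disj: "disjoint (std_blocks Y)"
  proof (rule disjointI)
    fix a a' assume "a \<in> std_blocks Y" "a' \<in> std_blocks Y" "a \<noteq> a'"
    then obtain b b' where b: "b \<in> Y" "b' \<in> Y" "a = rank_in S ` b" "a' = rank_in S ` b'"
      by (auto simp: eq)
    with \<open>a \<noteq> a'\<close> have "b \<inter> b' = {}" using \<open>disjoint Y\<close> by (metis disjointD)
    then show "a \<inter> a' = {}"
      using b inj_on_image_Int[OF inj sub sub, of b b'] by simp
  qed
  have "partition_on {1..card S} (std_blocks Y)"
    using un disj ne by (auto simp: partition_on_def eq)
  moreover have "noncrossing (std_blocks Y)"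
    unfolding noncrossing_def
  proof (intro ballI impI notI)
    fix a a' assume "a \<in> std_blocks Y" "a' \<in> std_blocks Y" and neq: "a \<noteq> a'"
    then obtain b b' where b: "b \<in> Y" "b' \<in> Y" "a = rank_in S ` b" "a' = rank_in S ` b'"
      by (auto simp: eq)
    assume "\<exists>x\<in>a. \<exists>y\<in>a'. \<exists>z\<in>a. \<exists>t\<in>a'. x < y \<and> y < z \<and> z < t"
    then obtain x y z t where h: "x \<in> b" "y \<in> b'" "z \<in> b" "t \<in> b'"
      "rank_in S x < rank_in S y" "rank_in S y < rank_in S z" "rank_in S z < rank_in S t"
      using b by auto
    have S: "x \<in> S" "y \<in> S" "z \<in> S" "t \<in> S"
      using h(1-4) sub[OF b(1)] sub[OF b(2)] by (simp_all add: subsetD)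
    have lt: "x < y" "y < z" "z < t"
      using h(5-7) S by (simp_all add: rank_in_strict_mono[OF fin])
    have "b \<in> P" "b' \<in> P" using b(1,2) Y(1) by (simp_all add: subsetD)
    moreover have "b \<noteq> b'" using b(3,4) neq by metis
    ultimately have "\<not> (\<exists>x\<in>b. \<exists>y\<in>b'. \<exists>z\<in>b. \<exists>t\<in>b'. x < y \<and> y < z \<and> z < t)"
      by (rule nc[unfolded noncrossing_def, THEN bspec, THEN bspec, THEN mp])
    moreover have "\<exists>x\<in>b. \<exists>y\<in>b'. \<exists>z\<in>b. \<exists>t\<in>b'. x < y \<and> y < z \<and> z < t"
      using h(1-4) lt by (intro bexI conjI)
    ultimately show False by (rule notE)
  qed
  ultimately show ?thesis
    unfolding NCP_def using card by blast
qed

text \<open>\<open>Abs_ncp\<close> is only applied to elements of \<open>NCP\<close> in what follows: see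
  \<open>singletons_NCP\<close> (with \<open>n \<ge> 1\<close>), \<open>std_blocks_NCP\<close> and, for \<open>r \<in> Ec \<pi>\<close>, \<open>merge_blocks_NCP\<close>.\<close>

definition J :: "nat \<Rightarrow> ncp" where
  "J n = Abs_ncp (singletons n)"

definition restrict_ncp :: "nat set set \<Rightarrow> ncp" where
  "restrict_ncp Y = Abs_ncp (std_blocks Y)"

definition nesting_le :: "nat set \<Rightarrow> nat set \<Rightarrow> bool" where
  "nesting_le b b' \<longleftrightarrow> b' \<subseteq> {Min b..Max b}"

definition le_ext :: "ncp \<Rightarrow> nat" where
  "le_ext \<pi> = card {f \<in> blocks \<pi> \<rightarrow>\<^sub>E {1..card (blocks \<pi>)}.
     bij_betw f (blocks \<pi>) {1..card (blocks \<pi>)} \<and>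
     (\<forall>b\<in>blocks \<pi>. \<forall>b'\<in>blocks \<pi>. nesting_le b b' \<longrightarrow> f b \<le> f b')}"

definition merge_blocks :: "nat set set \<Rightarrow> (nat set \<times> nat set) set \<Rightarrow> nat set set" where
  "merge_blocks P r = \<Union> ` (P // r)"

definition quotient_ncp :: "ncp \<Rightarrow> (nat set \<times> nat set) set \<Rightarrow> ncp" where
  "quotient_ncp \<pi> r = Abs_ncp (merge_blocks (blocks \<pi>) r)"

definition Ec :: "ncp \<Rightarrow> (nat set \<times> nat set) set set" where
  "Ec \<pi> = {r. equiv (blocks \<pi>) r \<and> noncrossing (merge_blocks (blocks \<pi>) r)}"


lemma merge_blocks_NCP:
  assumes r: "r \<in> Ec \<pi>"
  shows "merge_blocks (blocks \<pi>) r \<in> NCP"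
proof -
  define P where "P = blocks \<pi>"
  have "P \<in> NCP" using blocks by (simp add: P_def)
  then obtain n where n: "n \<ge> 1" "partition_on {1..n} P" by (auto simp: NCP_def)
  have eq: "equiv P r" and nc: "noncrossing (merge_blocks P r)" using r by (auto simp: Ec_def P_def)
  have sub: "C \<subseteq> P" "C \<noteq> {}" if "C \<in> P // r" for C
    using in_quotient_imp_subset[OF eq that] in_quotient_imp_non_empty[OF eq that] .
  have un: "\<Union>(merge_blocks P r) = {1..n}"
  proof -
    have "\<Union>(merge_blocks P r) = \<Union>(\<Union>(P // r))" unfolding merge_blocks_def by blast
    then show ?thesis using n(2) Union_quotient[OF eq] by (simp add: partition_on_def)
  qed
  have ne: "{} \<notin> merge_blocks P r"
  proof
    assume "{} \<in> merge_blocks P r"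
    then obtain C where C: "C \<in> P // r" "{} = \<Union>C"
      unfolding merge_blocks_def by (rule imageE)
    obtain b where b: "b \<in> C" using sub(2)[OF C(1)] by (meson ex_in_conv)
    have "b \<in> P" using b sub(1)[OF C(1)] by (rule rev_subsetD)
    moreover have "b = {}" using b C(2) by blast
    ultimately show False using n(2) by (auto simp: partition_on_def)
  qed
  have "disjoint (merge_blocks P r)"
  proof (rule disjointI)
    fix a a' assume "a \<in> merge_blocks P r" "a' \<in> merge_blocks P r" "a \<noteq> a'"
    then obtain C C' where C: "C \<in> P // r" "C' \<in> P // r" "a = \<Union>C" "a' = \<Union>C'" "C \<noteq> C'"
      unfolding merge_blocks_def by (metis imageE)
    then have CC: "C \<inter> C' = {}" using quotient_disj[OF eq C(1,2)] by simp
    have "b \<inter> b' = {}" if b: "b \<in> C" "b' \<in> C'" for b b'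
    proof -
      have "b \<noteq> b'" using b CC by blast
      moreover have "b \<in> P" "b' \<in> P"
        using b sub(1)[OF C(1)] sub(1)[OF C(2)] by (simp_all add: subsetD)
      ultimately show ?thesis using disjointD[OF partition_onD2[OF n(2)]] by simp
    qed
    then show "a \<inter> a' = {}" using C by blast
  qed
  then have "partition_on {1..n} (merge_blocks P r)" using un ne by (simp add: partition_on_def)
  then have "merge_blocks P r \<in> NCP"
    unfolding NCP_def using nc n(1) by blast
  then show ?thesis by (simp only: P_def)
qed


section \<open>Free commutative algebras\<close>

text \<open>The free commutative algebra on \<open>'x\<close> is the monoid algebra of the free commutative
  monoid \<open>'x \<Rightarrow>\<^sub>0 nat\<close>; its tensor square is the monoid algebra of the square of that monoid,
  with \<open>single m 1 \<otimes> single m' 1 = single (m, m') 1\<close>.\<close>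

type_synonym ('x, 'k) free_alg = "('x \<Rightarrow>\<^sub>0 nat) \<Rightarrow>\<^sub>0 'k"
type_synonym ('x, 'k) free_alg2 = "(('x \<Rightarrow>\<^sub>0 nat) \<times> ('x \<Rightarrow>\<^sub>0 nat)) \<Rightarrow>\<^sub>0 'k"

definition gen :: "'x \<Rightarrow> ('x, 'k::comm_ring_1) free_alg" where
  "gen x = Poly_Mapping.single (Poly_Mapping.single x 1) 1"

definition tensor ::
    "('x, 'k::comm_ring_1) free_alg \<Rightarrow> ('x, 'k) free_alg \<Rightarrow> ('x, 'k) free_alg2" where
  "tensor p q = (\<Sum>m\<in>Poly_Mapping.keys p. \<Sum>m'\<in>Poly_Mapping.keys q.
     Poly_Mapping.single (m, m') (Poly_Mapping.lookup p m * Poly_Mapping.lookup q m'))"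

text \<open>The algebra morphism extending \<open>f\<close>, into an algebra whose structure map is \<open>\<iota>\<close>.\<close>

definition free_lift ::
    "('k \<Rightarrow> 'b) \<Rightarrow> ('x \<Rightarrow> 'b) \<Rightarrow> ('x, 'k::comm_ring_1) free_alg \<Rightarrow> 'b::comm_ring_1" where
  "free_lift \<iota> f p = (\<Sum>m\<in>Poly_Mapping.keys p. \<iota> (Poly_Mapping.lookup p m) *
     (\<Prod>x\<in>Poly_Mapping.keys m. f x ^ Poly_Mapping.lookup m x))"

definition is_character :: "(('x, 'k::comm_ring_1) free_alg \<Rightarrow> 'k) \<Rightarrow> bool" where
  "is_character \<chi> \<longleftrightarrow>
     (\<forall>p q. \<chi> (p + q) = \<chi> p + \<chi> q) \<and>
     (\<forall>p q. \<chi> (p * q) = \<chi> p * \<chi> q) \<and>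
     (\<forall>c. \<chi> (Poly_Mapping.single 0 c) = c)"

text \<open>The linear form \<open>\<phi> \<otimes> \<mu>\<close>, followed by the multiplication of the base ring.\<close>

definition tensor_form :: "(('x, 'k::comm_ring_1) free_alg \<Rightarrow> 'k) \<Rightarrow> (('x, 'k) free_alg \<Rightarrow> 'k)
    \<Rightarrow> ('x, 'k) free_alg2 \<Rightarrow> 'k" where
  "tensor_form \<phi> \<mu> t = (\<Sum>(m, m')\<in>Poly_Mapping.keys t. Poly_Mapping.lookup t (m, m') *
     (\<phi> (Poly_Mapping.single m 1) * \<mu> (Poly_Mapping.single m' 1)))"


section \<open>The coproduct and the monoid of characters\<close>

type_synonym 'k ncp_alg = "(ncp, 'k) free_alg"

definition coprod :: "'k::comm_ring_1 ncp_alg \<Rightarrow> (ncp, 'k) free_alg2" where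
  "coprod = free_lift (Poly_Mapping.single 0)
     (\<lambda>\<pi>. \<Sum>r\<in>Ec \<pi>. tensor (gen (quotient_ncp \<pi> r)) (\<Prod>C\<in>blocks \<pi> // r. gen (restrict_ncp C)))"

definition conv :: "('k::comm_ring_1 ncp_alg \<Rightarrow> 'k) \<Rightarrow> ('k ncp_alg \<Rightarrow> 'k) \<Rightarrow> 'k ncp_alg \<Rightarrow> 'k"
    (infixl \<open>\<star>\<close> 70) where
  "\<phi> \<star> \<mu> = tensor_form \<phi> \<mu> \<circ> coprod"

definition eps_delta :: "'k::comm_ring_1 ncp_alg \<Rightarrow> 'k" where
  "eps_delta = free_lift id (\<lambda>\<pi>. if card (blocks \<pi>) = 1 then 1 else 0)"

definition lambda0 :: "'k::field_char_0 ncp_alg \<Rightarrow> 'k" where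
  "lambda0 = free_lift id (\<lambda>\<pi>. of_nat (le_ext \<pi>) / fact (card (blocks \<pi>)))"

definition is_conv_inverse :: "('k::comm_ring_1 ncp_alg \<Rightarrow> 'k) \<Rightarrow> ('k ncp_alg \<Rightarrow> 'k) \<Rightarrow> bool" where
  "is_conv_inverse \<chi> \<chi>' \<longleftrightarrow>
     is_character \<chi>' \<and> \<chi> \<star> \<chi>' = eps_delta \<and> \<chi>' \<star> \<chi> = eps_delta"


section \<open>Infinitesimal generators\<close>

text \<open>The sum is a limit for the \<open>X\<close>-adic topology.\<close>

definition is_inf_generator :: "'k::field_char_0 fps \<Rightarrow> 'k fps \<Rightarrow> bool" where
  "is_inf_generator g v \<longleftrightarrow> fps_nth v 0 = 0 \<and> fps_nth v 1 = 0 \<and>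
     (\<lambda>k. fps_const (1 / fact k) * ((\<lambda>h. v * fps_deriv h) ^^ k) fps_X) sums g"

definition inf_generator :: "'k::field_char_0 fps \<Rightarrow> 'k fps" where
  "inf_generator g = (THE v. is_inf_generator g v)"

end

theory Submission
  imports Defs "HOL-Library.Sublist"
begin

unbundle fps_syntax

text \<open>
  Write \<open>a j\<close> for the value of the inverse character at \<open>J j\<close>, let
  \<open>v = a 1 X\<^sup>2 + a 2 X\<^sup>3 + \<dots>\<close> and let \<open>D h = v * h'\<close>. The two claims follow from
  the fact that \<open>v\<close> itself is the infinitesimal generator of \<open>X + X\<^sup>2\<close>, so that the sign
  in the first claim is always \<open>+\<close>.

  Evaluate \<open>\<lambda>\<^sub>0 \<star> \<lambda> = \<epsilon>\<close> at \<open>J n\<close>. The quotients of \<open>J n\<close> are all the noncrossing partitions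
  of \<open>{1..n}\<close>, and restricting \<open>J n\<close> to a class of \<open>m\<close> points gives \<open>J m\<close>. Hence
  (\<open>conv_lambda0_J\<close>) the sum over noncrossing \<open>P\<close> of \<open>le(P) / |P|!\<close> times the product of
  \<open>a |b|\<close> over the blocks \<open>b\<close> of \<open>P\<close> is \<open>1\<close> for \<open>n = 1\<close> and \<open>0\<close> for \<open>n \<ge> 2\<close>.

  This sum is a coefficient of \<open>exp D\<close>. Indeed \<open>D\<close> sends \<open>X\<^bsup>m+1\<^esup>\<close> to the sum over \<open>j\<close> of
  \<open>(m + 1) a j X\<^bsup>m+j+1\<^esup>\<close>, and \<open>m + 1\<close> is the number of places at which \<open>j\<close>
  consecutive points can be inserted into a row of \<open>m\<close> points. So the coefficient of
  \<open>X\<^bsup>n+1\<^esup>\<close> in \<open>D\<^bsup>k\<^esup> X\<close> counts, with weights, the ways to build a row of \<open>n\<close> points by \<open>k\<close>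
  successive insertions of runs. Recording at each point the number of the insertion that created
  it gives a word in which no letter lies between two occurrences of a larger one
  (\<open>total_weight_Suc\<close>), and such words are the same thing as noncrossing partitions with a
  linear extension of the nesting order: the block with the last label is innermost, hence an
  interval, and can be removed (\<open>sum_nc_partitions_eq\<close>). Therefore \<open>exp D X = X + X\<^sup>2\<close>
  (\<open>inverse_generates\<close>).

  For the recurrence, \<open>exp D\<close> is an algebra morphism, hence the substitution of
  \<open>g = exp D X\<close> for \<open>X\<close>, and it commutes with \<open>D\<close>. Applying it to \<open>v = D X\<close> gives Julia's
  equation \<open>v \<circ> g = v * g'\<close>, whose coefficients for \<open>g = X + X\<^sup>2\<close> are the claimed recurrence
  (\<open>generator_recurrence\<close>). The recurrence determines \<open>v\<close>, which also gives the uniqueness of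
  the generator.
\<close>

section \<open>Exponentials of formal vector fields\<close>

definition vfield :: "'k::field_char_0 fps \<Rightarrow> 'k fps \<Rightarrow> 'k fps" where
  "vfield v h = v * fps_deriv h"

definition divided_iterate :: "'k::field_char_0 fps \<Rightarrow> nat \<Rightarrow> 'k fps \<Rightarrow> 'k fps" where
  "divided_iterate v k h = fps_const (1 / fact k) * (vfield v ^^ k) h"

text \<open>
  The value at \<open>h\<close> of the exponential of \<open>v d/dX\<close>. If \<open>v\<close> has order at least \<open>2\<close>, each application
  of \<open>v d/dX\<close> raises the order, so the terms with \<open>k > n\<close> of the exponential series vanish at
  degree \<open>n\<close> and the truncated sum is the whole coefficient; this is \<open>exp_vfield_sums\<close> below.
\<close>

definition exp_vfield :: "'k::field_char_0 fps \<Rightarrow> 'k fps \<Rightarrow> 'k fps" where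
  "exp_vfield v h = Abs_fps (\<lambda>n. \<Sum>k\<le>n. divided_iterate v k h $ n)"

lemma divided_iterate_0 [simp]: "divided_iterate v 0 h = h"
  by (simp add: divided_iterate_def)

lemma vfield_const_mult: "vfield v (fps_const c * h) = fps_const c * vfield v h"
  by (simp add: vfield_def algebra_simps)

lemma vfield_sum: "vfield v (\<Sum>i\<in>I. f i) = (\<Sum>i\<in>I. vfield v (f i))"
  by (induction I rule: infinite_finite_induct) (simp_all add: vfield_def algebra_simps)

lemma vfield_mult: "vfield v (f * h) = vfield v f * h + f * vfield v h"
  by (simp add: vfield_def algebra_simps)

lemma vfield_divided_iterate: "vfield v (divided_iterate v k h) = of_nat (Suc k) * divided_iterate v (Suc k) h"
proof -
  have "of_nat (Suc k) = fps_const (of_nat (Suc k) :: 'a)"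
    by (rule fps_of_nat[symmetric])
  moreover have "fps_const (of_nat (Suc k)) * fps_const (1 / fact (Suc k)) = (fps_const (1 / fact k) :: 'a fps)"
    by (simp add: divide_simps del: of_nat_Suc)
  ultimately show ?thesis
    unfolding divided_iterate_def vfield_const_mult by (simp add: mult.assoc[symmetric] del: of_nat_Suc fps_const_mult)
qed

lemma divided_iterate_vfield: "divided_iterate v k (vfield v h) = vfield v (divided_iterate v k h)"
  unfolding divided_iterate_def vfield_const_mult by (simp add: funpow_swap1)

text \<open>
  Leibniz' rule. With the factorials divided out there are no binomial coefficients: since
  \<open>D D\<^sub>k = (k + 1) D\<^sub>k\<^sub>+\<^sub>1\<close>, where \<open>D\<^sub>k\<close> is the \<open>k\<close>-th divided iterate, applying \<open>D\<close> to the formula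
  for \<open>k\<close> produces the \<open>i\<close>-th term of the formula for \<open>k + 1\<close> with weights \<open>i\<close> and \<open>k + 1 - i\<close>.
\<close>

lemma divided_iterate_mult: "divided_iterate v k (f * h) = (\<Sum>i\<le>k. divided_iterate v i f * divided_iterate v (k - i) h)"
proof (induction k)
  case (Suc k)
  define F where "F i = divided_iterate v i f" for i
  define H where "H i = divided_iterate v i h" for i
  have "of_nat (Suc k) * divided_iterate v (Suc k) (f * h) = (\<Sum>i\<le>k. vfield v (F i) * H (k - i)) + (\<Sum>i\<le>k. F i * vfield v (H (k - i)))"
    unfolding vfield_divided_iterate[symmetric] Suc vfield_sum vfield_mult sum.distrib F_def H_def ..
  also have "(\<Sum>i\<le>k. vfield v (F i) * H (k - i)) = (\<Sum>i\<le>k. of_nat (Suc i) * (F (Suc i) * H (Suc k - Suc i)))"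
    unfolding F_def H_def vfield_divided_iterate by (simp add: mult.assoc del: of_nat_Suc)
  also have "\<dots> = (\<Sum>i\<le>Suc k. of_nat i * (F i * H (Suc k - i)))"
    by (subst sum.atMost_Suc_shift) simp
  also have "(\<Sum>i\<le>k. F i * vfield v (H (k - i))) = (\<Sum>i\<le>k. of_nat (Suc k - i) * (F i * H (Suc k - i)))"
    unfolding H_def vfield_divided_iterate
    by (intro sum.cong refl) (simp add: Suc_diff_le mult_ac del: of_nat_Suc)
  also have "\<dots> = (\<Sum>i\<le>Suc k. of_nat (Suc k - i) * (F i * H (Suc k - i)))"
    by simp
  also have "(\<Sum>i\<le>Suc k. of_nat i * (F i * H (Suc k - i))) + \<dots> = (\<Sum>i\<le>Suc k. of_nat (Suc k) * (F i * H (Suc k - i)))"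
    unfolding sum.distrib[symmetric]
    by (intro sum.cong refl) (simp add: distrib_right[symmetric] of_nat_add[symmetric] del: of_nat_Suc of_nat_add)
  finally have "of_nat (Suc k) * divided_iterate v (Suc k) (f * h) = of_nat (Suc k) * (\<Sum>i\<le>Suc k. F i * H (Suc k - i))"
    unfolding sum_distrib_left .
  then show ?case unfolding F_def H_def
    by (simp del: of_nat_Suc sum.atMost_Suc)
qed simp

lemma vfield_nth: "vfield v h $ n = (\<Sum>i=0..n. v $ i * (of_nat (n - i + 1) * h $ (n - i + 1)))"
  by (simp add: vfield_def fps_mult_nth)

context
  fixes v :: "'k::field_char_0 fps"
  assumes v0: "v $ 0 = 0" and v1: "v $ 1 = 0"
begin

lemma vfield_vanish:
  assumes "\<And>m. m < k \<Longrightarrow> h $ m = 0" "m < Suc k"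
  shows "vfield v h $ m = 0"
  unfolding vfield_nth
proof (intro sum.neutral ballI)
  fix i assume "i \<in> {0..m}"
  consider "i = 0" | "i = 1" | "i \<ge> 2" by linarith
  then show "v $ i * (of_nat (m - i + 1) * h $ (m - i + 1)) = 0"
  proof cases
    case 3
    with assms(2) \<open>i \<in> {0..m}\<close> have "m - i + 1 < k" by auto
    then show ?thesis using assms(1) by simp
  qed (use v0 v1 in simp_all)
qed

lemma divided_iterate_vanish: "n < k \<Longrightarrow> divided_iterate v k h $ n = 0"
proof -
  have "n < k \<Longrightarrow> (vfield v ^^ k) h $ n = 0" for n
    by (induction k arbitrary: n) (auto intro: vfield_vanish)
  then show "n < k \<Longrightarrow> divided_iterate v k h $ n = 0" by (simp add: divided_iterate_def)
qed

lemma exp_vfield_nth: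
  assumes "n \<le> N"
  shows "exp_vfield v h $ n = (\<Sum>k\<le>N. divided_iterate v k h $ n)"
  unfolding exp_vfield_def fps_nth_Abs_fps
  using assms by (intro sum.mono_neutral_left) (auto intro: divided_iterate_vanish)

lemma exp_vfield_sums: "(\<lambda>k. divided_iterate v k h) sums exp_vfield v h"
  unfolding sums_def
proof (rule tendsto_fpsI)
  fix n
  show "eventually (\<lambda>N. (\<Sum>k<N. divided_iterate v k h) $ n = exp_vfield v h $ n) sequentially"
    using eventually_gt_at_top[of n]
  proof eventually_elim
    case (elim N)
    then have "{..<N} = {..N - 1}" "n \<le> N - 1" by auto
    then show ?case by (simp add: fps_sum_nth exp_vfield_nth)
  qed
qed

text \<open>
  By Leibniz' rule the coefficient at degree \<open>n\<close> is a sum over the triangle \<open>i + j \<le> n\<close> of products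
  of divided iterates. Outside the triangle these products have order larger than \<open>n\<close>, so the
  triangle may be replaced by the square, which factors.
\<close>

lemma exp_vfield_mult: "exp_vfield v (f * h) = exp_vfield v f * exp_vfield v h"
proof (rule fps_ext)
  fix n
  have vanish: "(divided_iterate v i f * divided_iterate v j h) $ n = 0" if "i + j > n" for i j
    unfolding fps_mult_nth
  proof (intro sum.neutral ballI)
    fix m assume "m \<in> {0..n}"
    with that have "m < i \<or> n - m < j" by auto
    then show "divided_iterate v i f $ m * divided_iterate v j h $ (n - m) = 0" by (auto simp: divided_iterate_vanish)
  qed
  have "exp_vfield v (f * h) $ n = (\<Sum>k\<le>n. \<Sum>i\<le>k. (divided_iterate v i f * divided_iterate v (k - i) h) $ n)"
    by (simp add: exp_vfield_def divided_iterate_mult fps_sum_nth)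
  also have "\<dots> = (\<Sum>(i, j)\<in>{(i, j). i + j \<le> n}. (divided_iterate v i f * divided_iterate v j h) $ n)"
    by (rule sum.triangle_reindex_eq[symmetric])
  also have "\<dots> = (\<Sum>(i, j)\<in>{..n} \<times> {..n}. (divided_iterate v i f * divided_iterate v j h) $ n)"
    by (rule sum.mono_neutral_left) (auto intro!: vanish)
  also have "\<dots> = ((\<Sum>i\<le>n. divided_iterate v i f) * (\<Sum>j\<le>n. divided_iterate v j h)) $ n"
    by (simp add: sum_product fps_sum_nth sum.cartesian_product[symmetric])
  also have "\<dots> = (exp_vfield v f * exp_vfield v h) $ n"
    unfolding fps_mult_nth
    by (intro sum.cong refl arg_cong2[where f = "(*)"])
       (simp_all add: fps_sum_nth exp_vfield_nth[of _ n])
  finally show "exp_vfield v (f * h) $ n = (exp_vfield v f * exp_vfield v h) $ n" .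
qed

lemma divided_iterate_add: "divided_iterate v k (f + h) = divided_iterate v k f + divided_iterate v k h"
proof -
  have "(vfield v ^^ k) (f + h) = (vfield v ^^ k) f + (vfield v ^^ k) h"
    by (induction k) (simp_all add: vfield_def algebra_simps)
  then show ?thesis by (simp add: divided_iterate_def algebra_simps)
qed

lemma exp_vfield_add: "exp_vfield v (f + h) = exp_vfield v f + exp_vfield v h"
  by (rule fps_ext) (simp add: exp_vfield_def divided_iterate_add sum.distrib)

lemma exp_vfield_const: "exp_vfield v (fps_const c) = fps_const c"
proof -
  have *: "vfield v 0 = 0" "vfield v (fps_const c) = 0" by (simp_all add: vfield_def)
  have "(vfield v ^^ Suc k) (fps_const c) = 0" for k
    by (induction k) (simp_all add: *)
  then have "divided_iterate v k (fps_const c) = (if k = 0 then fps_const c else 0)" for k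
    by (cases k) (simp_all add: divided_iterate_def)
  then show ?thesis by (intro fps_ext) (simp add: exp_vfield_def if_distrib[of "\<lambda>f. f $ _"] cong: if_cong)
qed

lemma exp_vfield_vfield: "exp_vfield v (vfield v h) = vfield v (exp_vfield v h)"
proof (rule fps_ext)
  fix n
  \<comment> \<open>The derivative in \<open>vfield v\<close> reads the coefficient at \<open>n + 1\<close>, hence the truncation at \<open>Suc n\<close>.\<close>
  have "exp_vfield v (vfield v h) $ n = (\<Sum>k\<le>Suc n. vfield v (divided_iterate v k h) $ n)"
    by (simp add: exp_vfield_nth[of n "Suc n"] divided_iterate_vfield del: sum.atMost_Suc)
  also have "\<dots> = vfield v (\<Sum>k\<le>Suc n. divided_iterate v k h) $ n"
    by (simp add: vfield_sum fps_sum_nth del: sum.atMost_Suc)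
  also have "\<dots> = vfield v (exp_vfield v h) $ n"
    unfolding vfield_nth
    by (intro sum.cong refl) (simp add: exp_vfield_nth[of _ "Suc n"] fps_sum_nth del: sum.atMost_Suc)
  finally show "exp_vfield v (vfield v h) $ n = vfield v (exp_vfield v h) $ n" .
qed

text \<open>
  Both sides are algebra morphisms in \<open>h\<close> that agree on constants and on \<open>X\<close>. Writing
  \<open>h = h 0 + X h\<^sub>1\<close>, their difference at \<open>h\<close> is \<open>g\<close> times their difference at \<open>h\<^sub>1\<close>, and as
  \<open>g\<close> has no constant term this shifts the coefficients down, which allows an induction on the degree.
\<close>

lemma exp_vfield_eq_compose: "exp_vfield v h = h oo exp_vfield v fps_X"
proof -
  define g where "g = exp_vfield v fps_X"
  have g0: "g $ 0 = 0" by (simp add: g_def exp_vfield_def)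
  have "(exp_vfield v h - (h oo g)) $ n = 0" for n
  proof (induction n arbitrary: h rule: less_induct)
    case (less n)
    define h' where "h' = fps_shift 1 h"
    have h: "h = fps_const (h $ 0) + fps_X * h'"
      by (rule fps_ext) (simp add: h'_def)
    have "exp_vfield v h - (h oo g) = g * (exp_vfield v h' - (h' oo g))"
      by (subst (1 2) h) (simp add: exp_vfield_add exp_vfield_mult exp_vfield_const fps_compose_add_distrib
        fps_compose_mult_distrib[OF g0] g_def[symmetric] fps_X_fps_compose_startby0[OF g0] algebra_simps)
    also have "\<dots> $ n = (\<Sum>i=0..n. g $ i * (exp_vfield v h' - (h' oo g)) $ (n - i))"
      by (rule fps_mult_nth)
    also have "\<dots> = 0"
    proof (intro sum.neutral ballI)
      fix i assume "i \<in> {0..n}"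
      show "g $ i * (exp_vfield v h' - (h' oo g)) $ (n - i) = 0"
        using g0 less[of "n - i" h'] \<open>i \<in> {0..n}\<close> by (cases "i = 0") auto
    qed
    finally show ?case .
  qed
  then show ?thesis by (intro fps_ext) (simp add: g_def)
qed

text \<open>
  Obtained by applying the exponential of \<open>D = v d/dX\<close> to \<open>v = D X\<close> in two ways: as a substitution,
  and by letting it commute with \<open>D\<close>.
\<close>

lemma julia_equation: "v oo exp_vfield v fps_X = v * fps_deriv (exp_vfield v fps_X)"
  using exp_vfield_vfield[of fps_X] exp_vfield_eq_compose[of v] by (simp add: vfield_def)

end

section \<open>The generator of \<open>X + X\<^sup>2\<close>\<close>

lemma is_inf_generator_iff:
  "is_inf_generator g v \<longleftrightarrow> v $ 0 = 0 \<and> v $ 1 = 0 \<and> exp_vfield v fps_X = g"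
proof -
  have "vfield v = (\<lambda>h. v * fps_deriv h)" by (simp add: vfield_def fun_eq_iff)
  then have eq: "(\<lambda>k. fps_const (1 / fact k) * ((\<lambda>h. v * fps_deriv h) ^^ k) fps_X)
      = (\<lambda>k. divided_iterate v k fps_X)"
    unfolding divided_iterate_def by (simp only:)
  show ?thesis
    unfolding is_inf_generator_def eq
    using exp_vfield_sums[of v fps_X] sums_unique2[of "\<lambda>k. divided_iterate v k fps_X"] by blast
qed

text \<open>
  For \<open>g = X + X\<^sup>2\<close> Julia's equation reads \<open>\<Sum>\<^sub>i v\<^sub>i X\<^sup>i (1 + X)\<^sup>i = (1 + 2 X) v\<close>, and the recurrence
  is its coefficient at degree \<open>n + 2\<close>: there \<open>v\<^sub>n\<^sub>+\<^sub>2\<close> cancels, and the two terms in \<open>v\<^sub>n\<^sub>+\<^sub>1\<close>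
  combine to \<open>n + 1 - 2 = n - 1\<close> times that coefficient.
\<close>

lemma generator_recurrence:
  fixes v :: "'k::field_char_0 fps"
  assumes v: "is_inf_generator (fps_X * (1 + fps_X)) v" and n: "n \<ge> 2"
  shows "v $ (n + 1) = - (1 / of_nat (n - 1)) *
    (\<Sum>i=1..n div 2. of_nat ((n - i + 1) choose (i + 1)) * v $ (n - i + 1))"
proof -
  define g :: "'k fps" where "g = fps_X * (1 + fps_X)"
  have v0: "v $ 0 = 0" and v1: "v $ 1 = 0" and fl: "exp_vfield v fps_X = g"
    using v by (simp_all add: is_inf_generator_iff g_def)
  have julia: "v oo g = v * fps_deriv g" using julia_equation[OF v0 v1] fl by simp
  have pow: "(g ^ i) $ m = (if m < i then 0 else of_nat (i choose (m - i)))" for i m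
    unfolding g_def power_mult_distrib fps_binomial_of_nat[symmetric]
    by (simp add: fps_X_power_mult_nth binomial_gbinomial)
  define S where "S = (\<Sum>i=1..n div 2. of_nat ((n - i + 1) choose (i + 1)) * v $ (n - i + 1))"
  have "(v oo g) $ (n + 2) = (\<Sum>i=0..n+2. v $ i * of_nat (i choose (n + 2 - i)))"
    unfolding fps_compose_nth pow by (intro sum.cong) auto
  also have "\<dots> = (\<Sum>i=0..n+2. v $ (n + 2 - i) * of_nat ((n + 2 - i) choose i))"
    by (subst sum.atLeastAtMost_rev) simp
  also have "\<dots> = v $ (n + 2) + of_nat (n + 1) * v $ (n + 1)
      + (\<Sum>i=2..n+2. v $ (n + 2 - i) * of_nat ((n + 2 - i) choose i))"
    by (simp add: sum.atLeast_Suc_atMost numeral_2_eq_2)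
  also have "(\<Sum>i=2..n+2. v $ (n + 2 - i) * of_nat ((n + 2 - i) choose i))
      = (\<Sum>i=1..n+1. of_nat ((n - i + 1) choose (i + 1)) * v $ (n - i + 1))"
  proof -
    have "v $ (n + 2 - Suc i) * of_nat ((n + 2 - Suc i) choose Suc i)
        = of_nat ((n - i + 1) choose (i + 1)) * v $ (n - i + 1)" if "i \<in> {1..n+1}" for i
    proof (cases "i \<le> n")
      case True
      then have "n + 2 - Suc i = n - i + 1" by simp
      then show ?thesis by simp
    next
      case False
      with that have "i = n + 1" by simp
      then show ?thesis using v0 v1 by simp
    qed
    then show ?thesis
      using sum.shift_bounds_cl_Suc_ivl[of "\<lambda>i. v $ (n + 2 - i) * of_nat ((n + 2 - i) choose i)" 1 "n+1"]
      by (simp add: numeral_2_eq_2 del: sum.cl_ivl_Suc)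
  qed
  \<comment> \<open>For \<open>i > n div 2\<close> the binomial coefficient vanishes, its lower index exceeding its upper one.\<close>
  also have "\<dots> = S"
    unfolding S_def by (rule sum.mono_neutral_right) (auto simp: binomial_eq_0)
  finally have L: "(v oo g) $ (n + 2) = v $ (n + 2) + of_nat (n + 1) * v $ (n + 1) + S" .
  have dg: "fps_deriv g = 1 + fps_const 2 * fps_X"
    by (simp add: g_def algebra_simps flip: numeral_fps_const)
  have "(v * fps_deriv g) $ (n + 2) = v $ (n + 2) + 2 * v $ (n + 1)"
    unfolding dg by (simp add: distrib_left mult.left_commute[of v])
  with L julia have "of_nat (n + 1) * v $ (n + 1) + S = 2 * v $ (n + 1)" by simp
  moreover have "(of_nat (n + 1) :: 'k) = of_nat (n - 1) + 2"
    using n by (simp add: of_nat_diff)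
  ultimately have "of_nat (n - 1) * v $ (n + 1) = - S"
    by (simp add: algebra_simps add_eq_0_iff)
  moreover have "(of_nat (n - 1) :: 'k) \<noteq> 0" using n by (simp only: of_nat_eq_0_iff)
  ultimately show ?thesis unfolding S_def[symmetric] by (simp add: field_simps)
qed

lemma generator_coeff_2:
  fixes v :: "'k::field_char_0 fps"
  assumes "is_inf_generator (fps_X * (1 + fps_X)) v"
  shows "v $ 2 = 1"
proof -
  have v0: "v $ 0 = 0" and v1: "v $ 1 = 0" and fl: "exp_vfield v fps_X = fps_X * (1 + fps_X)"
    using assms by (simp_all add: is_inf_generator_iff)
  have "divided_iterate v 2 fps_X $ 2 = 0"
    by (simp add: divided_iterate_def vfield_def numeral_2_eq_2 fps_mult_nth v0 v1[simplified])
  moreover have "divided_iterate v 1 fps_X = v" by (simp add: divided_iterate_def vfield_def)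
  ultimately have "exp_vfield v fps_X $ 2 = v $ 2"
    unfolding exp_vfield_def by (simp add: atMost_nat_numeral numeral_2_eq_2)
  then show ?thesis unfolding fl by (simp add: algebra_simps power2_eq_square[symmetric])
qed

text \<open>
  The recurrence expresses every coefficient of degree at least \<open>3\<close> by lower ones.
\<close>

lemma generator_unique:
  fixes v w :: "'k::field_char_0 fps"
  assumes "is_inf_generator (fps_X * (1 + fps_X)) v" "is_inf_generator (fps_X * (1 + fps_X)) w"
  shows "v = w"
proof (rule fps_ext)
  fix n
  show "v $ n = w $ n"
  proof (induction n rule: less_induct)
    case (less n)
    consider "n = 0" | "n = 1" | "n = 2" | m where "n = m + 1" "m \<ge> 2"
      by (metis One_nat_def Suc_1 add.commute less_2_cases_iff not_less plus_1_eq_Suc not0_implies_Suc le_less_Suc_eq leI nat_less_le Suc_leI)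
    then show ?case
    proof cases
      case 4
      have "(\<Sum>i=1..m div 2. of_nat ((m - i + 1) choose (i + 1)) * v $ (m - i + 1))
          = (\<Sum>i=1..m div 2. of_nat ((m - i + 1) choose (i + 1)) * w $ (m - i + 1))"
        by (intro sum.cong refl arg_cong2[where f = "(*)"] less) (auto simp: 4)
      then show ?thesis
        unfolding 4(1) generator_recurrence[OF assms(1) 4(2)] generator_recurrence[OF assms(2) 4(2)]
        by simp
    qed (use assms in \<open>auto simp: is_inf_generator_iff generator_coeff_2\<close>)
  qed
qed

section \<open>Words built by inserting runs\<close>

text \<open>
  The letter at a position is the number of the insertion by which that position was created; a run
  inserted later may separate the letters of an earlier one, but not conversely.
\<close>

definition nested_words :: "nat \<Rightarrow> nat \<Rightarrow> nat list set" where
  "nested_words k n = {w. length w = n \<and> set w = {1..k} \<and> (\<forall>x y. subseq [x, y, x] w \<longrightarrow> x \<le> y)}"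

text \<open>
  The triple consists of the length of the new run, its position and the old word.
\<close>

definition insert_run :: "nat \<Rightarrow> nat \<times> nat \<times> nat list \<Rightarrow> nat list" where
  "insert_run c = (\<lambda>(j, p, w). take p w @ replicate j c @ drop p w)"

lemma nested_wordsI:
  assumes "length w = n" "set w = {1..k}" "\<And>x y. subseq [x, y, x] w \<Longrightarrow> x \<le> y"
  shows "w \<in> nested_words k n"
  using assms unfolding nested_words_def by blast

lemma nested_wordsD:
  assumes "w \<in> nested_words k n"
  shows "length w = n" "set w = {1..k}" "subseq [x, y, x] w \<Longrightarrow> x \<le> y"
  using assms unfolding nested_words_def by blast+

lemma finite_nested_words: "finite (nested_words k n)"
  by (rule finite_subset[OF _ finite_lists_length_eq[of "{1..k}" n]]) (auto simp: nested_words_def)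

lemma nested_words_0: "nested_words 0 n = (if n = 0 then {[]} else {})"
  by (auto simp: nested_words_def)

lemma subseq_Cons_append_notin:
  "subseq (x # xs) (u @ v) \<Longrightarrow> x \<notin> set u \<Longrightarrow> subseq (x # xs) v"
  by (induction u) (auto split: if_splits)

lemma subseq_snoc_append_notin:
  assumes "subseq (xs @ [x]) (u @ v)" "x \<notin> set v"
  shows "subseq (xs @ [x]) u"
proof -
  obtain p q where pq: "xs @ [x] = p @ q" "subseq p u" "subseq q v"
    using assms(1) unfolding subseq_append_iff by blast
  have "q = []"
  proof (rule ccontr)
    assume "q \<noteq> []"
    with pq(1) have "x \<in> set q" by (metis last_appendR last_in_set last_snoc)
    with assms(2) show False using list_emb_set[OF pq(3)] by blast
  qed
  with pq show ?thesis by simp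
qed

text \<open>
  A pattern \<open>x y x\<close> with \<open>y < x\<close> cannot involve the new largest letter: if \<open>x\<close> is the new letter,
  then \<open>y\<close> lies within its run and equals it. Deleting the run therefore leaves a forbidden pattern in
  the old word.
\<close>

lemma insert_run_nested:
  assumes w: "w \<in> nested_words k m" and j: "j \<ge> 1"
  shows "insert_run (Suc k) (j, p, w) \<in> nested_words (Suc k) (m + j)"
proof -
  define c where "c = Suc k"
  define u where "u = take p w"
  define v where "v = drop p w"
  have uv: "w = u @ v" by (simp add: u_def v_def)
  have setw: "set u \<union> set v = {1..k}" "length u + length v = m"
    and nest: "\<And>x y. subseq [x, y, x] (u @ v) \<Longrightarrow> x \<le> y"
    using w unfolding nested_words_def uv by auto
  have "c \<notin> set u \<union> set v" unfolding setw by (simp add: c_def)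
  then have cn: "c \<notin> set u" "c \<notin> set v" by simp_all
  have ran: "y \<le> c" if "y \<in> set (u @ replicate j c @ v)" for y
  proof -
    have "y \<in> {1..k} \<union> {c}" using that setw by auto
    then show ?thesis by (auto simp: c_def)
  qed
  have nest': "x \<le> y" if s: "subseq [x, y, x] (u @ replicate j c @ v)" for x y
  proof (cases "x = c")
    case False
    show ?thesis
    proof (cases "y = c")
      case True
      then show ?thesis using ran[of x] list_emb_set[OF s, of x] by auto
    next
      case y: False
      have "filter (\<lambda>z. z \<noteq> c) u = u" "filter (\<lambda>z. z \<noteq> c) v = v"
        using cn by (auto simp: filter_id_conv)
      with subseq_filter[OF s, of "\<lambda>z. z \<noteq> c"] False y
      have "subseq [x, y, x] (u @ v)" by simp
      then show ?thesis by (rule nest)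
    qed
  next
    case True
    have "subseq [c, y, c] (replicate j c @ v)"
      using subseq_Cons_append_notin[of c "[y, c]" u] s cn True by simp
    then have "subseq [c, y, c] (replicate j c)"
      using subseq_snoc_append_notin[of "[c, y]" c "replicate j c" v] cn by simp
    then have "y \<in> set (replicate j c)"
      by (rule list_emb_set[of _ _ _ y]) simp_all
    then show ?thesis using True by simp
  qed
  have "{1..Suc k} = insert c (set u \<union> set v)" unfolding setw by (auto simp: c_def)
  then have set': "set (u @ replicate j c @ v) = {1..Suc k}"
    using j by auto
  have len': "length (u @ replicate j c @ v) = m + j" using setw(2) by simp
  have "insert_run (Suc k) (j, p, w) = u @ replicate j c @ v"
    by (simp add: insert_run_def u_def v_def c_def)
  then show ?thesis
    using nested_wordsI[OF len' set' nest'] by (simp only:)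
qed

text \<open>
  Everything between the first and the last occurrence of the largest letter is at least as large,
  hence equal to it: the occurrences form one run.
\<close>

lemma nested_word_split:
  assumes w: "w \<in> nested_words (Suc k) n"
  obtains u j v where "w = u @ replicate j (Suc k) @ v" "j \<ge> 1" "u @ v \<in> nested_words k (n - j)" "j \<le> n"
proof -
  define c where "c = Suc k"
  note w' = nested_wordsD[OF w, folded c_def]
  have "c \<in> set w" unfolding w'(2) by (simp add: c_def)
  then obtain u s where us: "w = u @ c # s" "c \<notin> set u"
    by (meson split_list_first)
  have "c \<in> set (c # s)" by simp
  from split_list_last[OF this] obtain m v where mv: "c # s = m @ c # v" "c \<notin> set v"
    by blast
  have w2: "w = u @ m @ c # v" unfolding us(1) mv(1) ..
  have "y = c" if y: "y \<in> set m" for y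
  proof (rule ccontr)
    assume "y \<noteq> c"
    obtain a m' where m': "m = a # m'" using y by (cases m) auto
    then have "a = c" using mv(1) by simp
    have "y \<in> set m'" using y m' \<open>a = c\<close> \<open>y \<noteq> c\<close> by simp
    then have "subseq [y] m'" by (simp only: subseq_singleton_left)
    moreover have "subseq [c] (c # v)" by (simp add: subseq_singleton_left)
    ultimately have "subseq ([y] @ [c]) (m' @ c # v)" by (rule list_emb_append_mono)
    then have "subseq (c # [y] @ [c]) (c # m' @ c # v)" by (rule subseq_Cons2)
    then have "subseq [c, y, c] w"
      unfolding w2 m' \<open>a = c\<close> append_Cons append_Nil by (rule subseq_drop_many)
    then have "c \<le> y" by (rule w'(3))
    moreover have "y \<in> set w" using y by (simp add: w2)
    then have "y \<le> c" by (simp add: w'(2))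
    ultimately show False using \<open>y \<noteq> c\<close> by simp
  qed
  then have "m = replicate (length m) c" by (simp add: replicate_length_same)
  then obtain l where m: "m = replicate l c" by blast
  have eq: "w = u @ replicate (Suc l) c @ v"
    unfolding w2 m by (simp add: replicate_app_Cons_same)
  have sub: "subseq (u @ v) w"
    unfolding eq by (rule list_emb_append_mono[OF subseq_order.refl subseq_drop_many[OF subseq_order.refl]])
  have nest: "x \<le> y" if "subseq [x, y, x] (u @ v)" for x y
    by (rule w'(3)[OF subseq_order.trans[OF that sub]])
  have set': "set (u @ v) = {1..k}"
  proof -
    have "set (u @ v) = set w - {c}" unfolding eq using us(2) mv(2) by auto
    moreover have "{1..c} - {c} = {1..k}" by (auto simp: c_def)
    ultimately show ?thesis unfolding w'(2) by (simp only:)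
  qed
  have len': "length (u @ v) = n - Suc l" "Suc l \<le> n"
    using w'(1) unfolding eq by auto
  show ?thesis
    by (rule that[OF eq[unfolded c_def] _ nested_wordsI[OF len'(1) set' nest] len'(2)]) simp
qed

definition run_choices :: "nat \<Rightarrow> nat \<Rightarrow> (nat \<times> nat \<times> nat list) set" where
  "run_choices k n = (SIGMA j:{1..n}. {0..n - j} \<times> nested_words k (n - j))"

text \<open>
  The old word is recovered by deleting the largest letter, and the position of the run as the length
  of the prefix before the first occurrence of that letter.
\<close>

lemma bij_betw_insert_run:
  "bij_betw (insert_run (Suc k)) (run_choices k n) (nested_words (Suc k) n)"
proof (intro bij_betw_imageI equalityI subsetI)
  define c where "c = Suc k"
  show "inj_on (insert_run (Suc k)) (run_choices k n)"
  proof (rule inj_onI)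
    fix s s' assume "s \<in> run_choices k n" "s' \<in> run_choices k n"
      and eq: "insert_run (Suc k) s = insert_run (Suc k) s'"
    obtain j p w where s1: "s = (j, p, w)" by (cases s)
    obtain j' p' w' where s2: "s' = (j', p', w')" by (cases s')
    note s = s1 s2
    have h: "1 \<le> j" "j \<le> n" "p \<le> n - j" "w \<in> nested_words k (n - j)"
        "1 \<le> j'" "j' \<le> n" "p' \<le> n - j'" "w' \<in> nested_words k (n - j')"
      using \<open>s \<in> _\<close> \<open>s' \<in> _\<close> by (simp_all add: run_choices_def s)
    have e: "take p w @ replicate j c @ drop p w = take p' w' @ replicate j' c @ drop p' w'"
      using eq by (simp add: s insert_run_def c_def)
    have len: "length w = n - j" "length w' = n - j'"
      and ran: "set w = {1..k}" "set w' = {1..k}"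
      by (fact nested_wordsD(1,2)[OF h(4)] nested_wordsD(1,2)[OF h(8)])+
    have cw: "c \<notin> set w" "c \<notin> set w'" unfolding ran by (simp_all add: c_def)
    have f: "filter (\<lambda>z. z \<noteq> c) (take q x @ replicate i c @ drop q x) = x" if "c \<notin> set x" for q i x
    proof -
      have "filter (\<lambda>z. z \<noteq> c) (take q x @ replicate i c @ drop q x) = filter (\<lambda>z. z \<noteq> c) (take q x @ drop q x)"
        by (simp del: append_take_drop_id)
      also have "\<dots> = x" using that by (auto simp: filter_id_conv)
      finally show ?thesis .
    qed
    have w: "w = w'"
      using arg_cong[OF e, of "filter (\<lambda>z. z \<noteq> c)"] unfolding f[OF cw(1)] f[OF cw(2)] .
    have t: "takeWhile (\<lambda>z. z \<noteq> c) (take q x @ replicate i c @ drop q x) = take q x"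
      if x: "c \<notin> set x" and i: "i \<ge> 1" for q i x
    proof -
      obtain i' where "i = Suc i'" using i by (cases i) auto
      moreover have "\<forall>z\<in>set (take q x). z \<noteq> c" using x set_take_subset[of q x] by blast
      ultimately show ?thesis by (simp add: takeWhile_append2)
    qed
    have "take p w = take p' w'"
      using arg_cong[OF e, of "takeWhile (\<lambda>z. z \<noteq> c)"] unfolding t[OF cw(1) h(1)] t[OF cw(2) h(5)] .
    then have "length (take p w) = length (take p' w')" by (rule arg_cong)
    then have "p = p'" using h(3,7) len by simp
    moreover have "j = j'" using len h(2,6) unfolding w by linarith
    ultimately show "s = s'" using s w by simp
  qed
next
  fix w assume "w \<in> insert_run (Suc k) ` run_choices k n"
  then obtain j p x where jpx: "w = insert_run (Suc k) (j, p, x)" "1 \<le> j" "j \<le> n" "x \<in> nested_words k (n - j)"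
    by (auto simp: run_choices_def)
  show "w \<in> nested_words (Suc k) n"
    using insert_run_nested[OF jpx(4,2), of p] jpx by simp
next
  fix w assume "w \<in> nested_words (Suc k) n"
  then obtain u j v where w: "w = u @ replicate j (Suc k) @ v" "j \<ge> 1" "u @ v \<in> nested_words k (n - j)" "j \<le> n"
    by (rule nested_word_split)
  have "length u \<le> n - j" using nested_wordsD(1)[OF w(3)] by simp
  then have "(j, length u, u @ v) \<in> run_choices k n" using w by (simp add: run_choices_def)
  moreover have "insert_run (Suc k) (j, length u, u @ v) = w" by (simp add: insert_run_def w(1))
  ultimately show "w \<in> insert_run (Suc k) ` run_choices k n" by (metis image_eqI)
qed

definition word_weight :: "(nat \<Rightarrow> 'k::comm_semiring_1) \<Rightarrow> nat list \<Rightarrow> 'k" where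
  "word_weight a w = (\<Prod>c\<in>set w. a (count_list w c))"

definition total_weight :: "(nat \<Rightarrow> 'k::comm_semiring_1) \<Rightarrow> nat \<Rightarrow> nat \<Rightarrow> 'k" where
  "total_weight a k n = (\<Sum>w\<in>nested_words k n. word_weight a w)"

lemma total_weight_0: "total_weight a 0 n = (if n = 0 then 1 else 0)"
  by (simp add: total_weight_def nested_words_0 word_weight_def)

lemma word_weight_insert_run:
  assumes w: "w \<in> nested_words k m" and j: "j \<ge> 1"
  shows "word_weight a (insert_run (Suc k) (j, p, w)) = a j * word_weight a w"
proof -
  define x where "x = insert_run (Suc k) (j, p, w)"
  have setw: "set w = {1..k}" using w by (rule nested_wordsD(2))
  have setx: "set x = insert (Suc k) (set w)"
    using nested_wordsD(2)[OF insert_run_nested[OF w j, of p]] by (simp add: setw x_def atLeastAtMostSuc_conv)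
  have cnt: "count_list x c = count_list w c + (if c = Suc k then j else 0)" for c
  proof -
    have "count_list (replicate j (Suc k)) c = (if c = Suc k then j else 0)"
      by (induction j) auto
    moreover have "count_list w c = count_list (take p w) c + count_list (drop p w) c"
      by (metis append_take_drop_id count_list_append)
    ultimately show ?thesis by (simp add: x_def insert_run_def)
  qed
  have "Suc k \<notin> set w" using setw by simp
  then have "word_weight a x = a j * (\<Prod>c\<in>set w. a (count_list x c))"
    unfolding word_weight_def setx by (simp add: cnt)
  also have "(\<Prod>c\<in>set w. a (count_list x c)) = word_weight a w"
    unfolding word_weight_def using \<open>Suc k \<notin> set w\<close> by (intro prod.cong) (auto simp: cnt)
  finally show ?thesis by (simp add: x_def)
qed

text \<open>
  The factor \<open>n - j + 1\<close> counts the positions for a run of length \<open>j\<close> in a word of length \<open>n - j\<close>.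
  This is the recursion satisfied by the coefficients of the iterates of \<open>v d/dX\<close> on \<open>X\<close>.
\<close>

lemma total_weight_Suc:
  "total_weight a (Suc k) n = (\<Sum>j=1..n. a j * of_nat (n - j + 1) * total_weight a k (n - j))"
proof -
  have "total_weight a (Suc k) n = (\<Sum>t\<in>run_choices k n. word_weight a (insert_run (Suc k) t))"
    unfolding total_weight_def by (rule sum.reindex_bij_betw[OF bij_betw_insert_run, symmetric])
  also have "\<dots> = (\<Sum>j=1..n. \<Sum>t\<in>{0..n - j} \<times> nested_words k (n - j). word_weight a (insert_run (Suc k) (j, t)))"
    unfolding run_choices_def by (subst sum.Sigma) (auto simp: finite_nested_words)
  also have "\<dots> = (\<Sum>j=1..n. \<Sum>p=0..n - j. \<Sum>w\<in>nested_words k (n - j). a j * word_weight a w)"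
    unfolding sum.cartesian_product
    by (intro sum.cong refl) (auto simp: word_weight_insert_run)
  also have "\<dots> = (\<Sum>j=1..n. a j * of_nat (n - j + 1) * total_weight a k (n - j))"
    by (simp add: total_weight_def sum_distrib_left mult_ac)
  finally show ?thesis .
qed

section \<open>Noncrossing partitions with linear extensions as words\<close>

lemma subseq_Cons_iff_nth:
  "subseq (x # xs) w \<longleftrightarrow> (\<exists>i<length w. w ! i = x \<and> subseq xs (drop (Suc i) w))"
proof
  assume "subseq (x # xs) w"
  then obtain us vs where "w = us @ x # vs" "subseq xs vs"
    using list_emb_ConsD by fastforce
  then show "\<exists>i<length w. w ! i = x \<and> subseq xs (drop (Suc i) w)"
    by (intro exI[of _ "length us"]) simp
next
  assume "\<exists>i<length w. w ! i = x \<and> subseq xs (drop (Suc i) w)"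
  then obtain i where i: "i < length w" "w ! i = x" "subseq xs (drop (Suc i) w)" by blast
  then have "subseq (x # xs) (take i w @ x # drop (Suc i) w)"
    by (intro subseq_drop_many subseq_Cons2)
  then show "subseq (x # xs) w" using id_take_nth_drop[OF i(1)] i(2) by simp
qed

lemma subseq_triple_iff_nth:
  "subseq [x, y, z] w \<longleftrightarrow>
    (\<exists>i j k. i < j \<and> j < k \<and> k < length w \<and> w ! i = x \<and> w ! j = y \<and> w ! k = z)" (is "?L \<longleftrightarrow> ?R")
proof
  assume ?L
  then obtain i where i: "i < length w" "w ! i = x" "subseq [y, z] (drop (Suc i) w)"
    unfolding subseq_Cons_iff_nth[of x] by blast
  then obtain j where j: "j < length w - Suc i" "drop (Suc i) w ! j = y"
      "subseq [z] (drop (Suc j) (drop (Suc i) w))"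
    unfolding subseq_Cons_iff_nth[of y] by auto
  then have "z \<in> set (drop (Suc j) (drop (Suc i) w))" by (simp only: subseq_singleton_left)
  then obtain k where "k < length (drop (Suc j) (drop (Suc i) w))" "drop (Suc j) (drop (Suc i) w) ! k = z"
    unfolding in_set_conv_nth by blast
  then have k: "k < length w - Suc i - Suc j" "drop (Suc j) (drop (Suc i) w) ! k = z" by simp_all
  show ?R
    by (rule exI[of _ i], rule exI[of _ "Suc i + j"], rule exI[of _ "Suc i + Suc j + k"])
       (use i j k in \<open>auto simp: add_ac\<close>)
next
  assume ?R
  then obtain i j k where h: "i < j" "j < k" "k < length w" "w ! i = x" "w ! j = y" "w ! k = z" by blast
  have "z \<in> set (drop (Suc j) w)"
    using h nth_mem[of "k - Suc j" "drop (Suc j) w"] by simp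
  then have "subseq [z] (drop (Suc j) w)" by (simp only: subseq_singleton_left)
  then have "subseq [y, z] (drop (Suc i) w)"
    unfolding subseq_Cons_iff_nth[of y] using h
    by (intro exI[of _ "j - Suc i"]) simp
  then show ?L unfolding subseq_Cons_iff_nth[of x] using h by (intro exI[of _ i]) simp
qed

definition nc_partitions :: "nat \<Rightarrow> nat set set set" where
  "nc_partitions n = {P. partition_on {1..n} P \<and> noncrossing P}"

definition linear_extensions :: "nat set set \<Rightarrow> (nat set \<Rightarrow> nat) set" where
  "linear_extensions P = {f \<in> P \<rightarrow>\<^sub>E {1..card P}. bij_betw f P {1..card P} \<and>
     (\<forall>b\<in>P. \<forall>b'\<in>P. nesting_le b b' \<longrightarrow> f b \<le> f b')}"

text \<open>
  The word of labels of the points of \<open>{1..n}\<close>, the point \<open>x\<close> being at list position \<open>x - 1\<close>.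
\<close>

definition label_word :: "nat \<Rightarrow> nat set set \<times> (nat set \<Rightarrow> nat) \<Rightarrow> nat list" where
  "label_word n = (\<lambda>(P, f). map (\<lambda>x. f (THE b. b \<in> P \<and> x \<in> b)) [1..<Suc n])"

definition fiber :: "nat list \<Rightarrow> nat \<Rightarrow> nat set" where
  "fiber w c = {x \<in> {1..length w}. w ! (x - 1) = c}"

text \<open>
  The inverse of \<open>label_word\<close>: the blocks are the positions of the individual letters, and the label
  of a block is the letter that it comes from. The restriction makes the labelling extensional, as the
  linear extensions counted by \<open>le_ext\<close> are.
\<close>

definition fibers_with_labels :: "nat list \<Rightarrow> nat set set \<times> (nat set \<Rightarrow> nat)" where
  "fibers_with_labels w =
     (fiber w ` set w, restrict (the_inv_into (set w) (fiber w)) (fiber w ` set w))"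

lemma finite_nc_partitions: "finite (nc_partitions n)"
  using finitely_many_partition_on[of "{1..n}"] by (rule finite_subset[rotated]) (auto simp: nc_partitions_def)

lemma finite_linear_extensions:
  assumes "finite P" shows "finite (linear_extensions P)"
  by (rule finite_subset[OF _ finite_PiE[OF assms, of "\<lambda>_. {1..card P}"]]) (auto simp: linear_extensions_def)

lemma label_word_block:
  assumes P: "partition_on {1..n} P" and b: "b \<in> P" and x: "x \<in> b"
  shows "x \<in> {1..n}" "label_word n (P, f) ! (x - 1) = f b"
proof -
  show xn: "x \<in> {1..n}" using partition_onD1[OF P] b x by blast
  have "(THE b. b \<in> P \<and> x \<in> b) = b"
    using b x disjointD[OF partition_onD2[OF P]] by (intro the_equality) blast+
  moreover obtain i where "x = Suc i" "i < n" using xn by (cases x) auto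
  ultimately show "label_word n (P, f) ! (x - 1) = f b"
    by (simp add: label_word_def del: upt_Suc)
qed

lemma length_label_word: "length (label_word n s) = n"
  by (simp add: label_word_def split: prod.split del: upt_Suc)

text \<open>
  A point \<open>y\<close> of a block \<open>b'\<close> lying strictly between two points of another block \<open>b\<close> means, for
  a noncrossing partition, that \<open>b'\<close> is nested in \<open>b\<close>, so an extension of the nesting order gives
  \<open>f b \<le> f b'\<close>. Conversely, in a crossing each of the two blocks has a point between two points of
  the other, which would force equal labels.
\<close>

lemma nested_iff_noncrossing_linear_extension:
  assumes P: "partition_on {1..n} P" and inj: "inj_on f P"
    and len: "length w = n" and w: "\<And>b x. b \<in> P \<Longrightarrow> x \<in> b \<Longrightarrow> w ! (x - 1) = f b"
  shows "(\<forall>x y. subseq [x, y, x] w \<longrightarrow> x \<le> y) \<longleftrightarrow>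
    noncrossing P \<and> (\<forall>b\<in>P. \<forall>b'\<in>P. nesting_le b b' \<longrightarrow> (f b::nat) \<le> f b')"
    (is "?W \<longleftrightarrow> ?N \<and> ?E")
proof -
  have un: "\<Union>P = {1..n}" using P by (simp add: partition_on_def)
  have fin: "finite b" and ne: "b \<noteq> {}" if "b \<in> P" for b
    using that P finite_subset[of b "{1..n}"] by (auto simp: partition_on_def)
  have same: "b = b'" if "b \<in> P" "b' \<in> P" "x \<in> b" "x \<in> b'" for b b' x
    using that disjointD[OF partition_onD2[OF P]] by blast
  have W: "?W \<longleftrightarrow> (\<forall>b\<in>P. \<forall>b'\<in>P. \<forall>x\<in>b. \<forall>y\<in>b'. \<forall>z\<in>b. x < y \<and> y < z \<longrightarrow> f b \<le> f b')" (is "_ \<longleftrightarrow> ?B")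
  proof
    assume W: ?W
    show ?B
    proof (intro ballI impI)
      fix b b' x y z assume h: "b \<in> P" "b' \<in> P" "x \<in> b" "y \<in> b'" "z \<in> b" "x < y \<and> y < z"
      then have r: "x \<in> {1..n}" "y \<in> {1..n}" "z \<in> {1..n}" using un by blast+
      have "subseq [f b, f b', f b] w"
        unfolding subseq_triple_iff_nth
        by (rule exI[of _ "x - 1"], rule exI[of _ "y - 1"], rule exI[of _ "z - 1"])
           (use h r len w[of b x] w[of b' y] w[of b z] in auto)
      with W show "f b \<le> f b'" by blast
    qed
  next
    assume B: ?B
    show ?W
    proof (intro allI impI)
      fix c d assume "subseq [c, d, c] w"
      then obtain i j k where h: "i < j" "j < k" "k < n" "w ! i = c" "w ! j = d" "w ! k = c"
        unfolding subseq_triple_iff_nth len by blast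
      then have "Suc i \<in> \<Union>P" "Suc j \<in> \<Union>P" "Suc k \<in> \<Union>P" unfolding un by auto
      then obtain b b' b'' where b: "b \<in> P" "b' \<in> P" "b'' \<in> P" "Suc i \<in> b" "Suc j \<in> b'" "Suc k \<in> b''"
        by blast
      have f: "f b = c" "f b' = d" "f b'' = c"
        using h w[OF b(1,4)] w[OF b(2,5)] w[OF b(3,6)] by simp_all
      then have "b'' = b" using inj b by (auto dest: inj_onD)
      moreover have "Suc i < Suc j \<and> Suc j < Suc k" using h by simp
      ultimately have "f b \<le> f b'" using B b by blast
      then show "c \<le> d" by (simp add: f)
    qed
  qed
  show ?thesis unfolding W
  proof (intro iffI conjI)
    assume B: ?B
    show ?N unfolding noncrossing_def
    proof (intro ballI impI notI)
      fix b b' assume b: "b \<in> P" "b' \<in> P" "b \<noteq> b'"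
        and "\<exists>x\<in>b. \<exists>y\<in>b'. \<exists>z\<in>b. \<exists>t\<in>b'. x < y \<and> y < z \<and> z < t"
      then obtain x y z t where "x \<in> b" "y \<in> b'" "z \<in> b" "t \<in> b'" "x < y" "y < z" "z < t" by blast
      then have "f b \<le> f b'" "f b' \<le> f b" using B b(1,2) by blast+
      then show False using inj b by (auto dest: inj_onD)
    qed
    show ?E
    proof (intro ballI impI)
      fix b b' assume b: "b \<in> P" "b' \<in> P" and nest: "nesting_le b b'"
      show "f b \<le> f b'"
      proof (cases "b = b'")
        case False
        obtain y where y: "y \<in> b'" using ne[OF b(2)] by blast
        have m: "Min b \<in> b" "Max b \<in> b" using fin ne b(1) by simp_all
        have "y \<noteq> Min b" "y \<noteq> Max b" using same[OF b _ y] m False by blast+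
        moreover have "Min b \<le> y" "y \<le> Max b" using nest y by (auto simp: nesting_le_def)
        ultimately have "Min b < y \<and> y < Max b" by simp
        then show ?thesis using B b y m by blast
      qed simp
    qed
  next
    assume NE: "?N \<and> ?E"
    show ?B
    proof (intro ballI impI)
      fix b b' x y z assume h: "b \<in> P" "b' \<in> P" "x \<in> b" "y \<in> b'" "z \<in> b" and o: "x < y \<and> y < z"
      show "f b \<le> f b'"
      proof (cases "b = b'")
        case False
        have "t \<in> {Min b..Max b}" if t: "t \<in> b'" for t
        proof -
          have "t \<noteq> x" "t \<noteq> z" using same[OF h(1,2) _ t] h False by blast+
          moreover have "\<not> t < x"
          proof
            assume "t < x"
            with t h o have "\<exists>x\<in>b'. \<exists>y\<in>b. \<exists>z\<in>b'. \<exists>t\<in>b. x < y \<and> y < z \<and> z < t" by blast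
            then show False using NE h(1,2) False unfolding noncrossing_def by blast
          qed
          moreover have "\<not> z < t"
          proof
            assume "z < t"
            with t h o have "\<exists>x\<in>b. \<exists>y\<in>b'. \<exists>z\<in>b. \<exists>t\<in>b'. x < y \<and> y < z \<and> z < t" by blast
            then show False using NE h(1,2) False unfolding noncrossing_def by blast
          qed
          moreover have "Min b \<le> x" "z \<le> Max b" using fin[OF h(1)] h by simp_all
          ultimately show ?thesis by simp
        qed
        then have "nesting_le b b'" unfolding nesting_le_def by blast
        then show ?thesis using NE h by blast
      qed simp
    qed
  qed
qed

lemma linear_extensionsD:
  assumes "f \<in> linear_extensions P"
  shows "f \<in> P \<rightarrow>\<^sub>E {1..card P}" "bij_betw f P {1..card P}"
    "\<forall>b\<in>P. \<forall>b'\<in>P. nesting_le b b' \<longrightarrow> f b \<le> f b'"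
  using assms unfolding linear_extensions_def by blast+

lemma label_word_properties:
  assumes P: "P \<in> nc_partitions n" and f: "f \<in> linear_extensions P"
  defines "w \<equiv> label_word n (P, f)"
  shows "w \<in> nested_words (card P) n" "set w = f ` P" "\<And>b. b \<in> P \<Longrightarrow> fiber w (f b) = b"
proof -
  have part: "partition_on {1..n} P" and nc: "noncrossing P" using P by (auto simp: nc_partitions_def)
  note fD = linear_extensionsD[OF f]
  have inj: "inj_on f P" and im: "f ` P = {1..card P}" using fD(2) by (simp_all add: bij_betw_def)
  have un: "\<Union>P = {1..n}" using part by (simp add: partition_on_def)
  have len: "length w = n" unfolding w_def by (rule length_label_word)
  note val = label_word_block(2)[OF part, of _ _ f, folded w_def]
  note ran = label_word_block(1)[OF part]
  have blk: "\<exists>b\<in>P. x \<in> b" if "x \<in> {1..n}" for x using that un by blast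
  show setw: "set w = f ` P"
  proof (intro equalityI subsetI)
    fix c assume "c \<in> set w"
    then obtain i where i: "i < n" "w ! i = c" unfolding in_set_conv_nth len by blast
    then have "Suc i \<in> {1..n}" by simp
    then obtain b where b: "b \<in> P" "Suc i \<in> b" using blk by blast
    have "c = f b" using val[OF b] i by simp
    with b show "c \<in> f ` P" by blast
  next
    fix c assume "c \<in> f ` P"
    then obtain b where b: "b \<in> P" "c = f b" by blast
    obtain x where x: "x \<in> b" using b(1) part by (metis partition_onD3 ex_in_conv)
    have "w ! (x - 1) = c" "x - 1 < length w" using val[OF b(1) x] b(2) ran[OF b(1) x] len by auto
    then show "c \<in> set w" by (metis nth_mem)
  qed
  show "w \<in> nested_words (card P) n"
  proof (rule nested_wordsI[OF len setw[unfolded im]])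
    have "(\<forall>x y. subseq [x, y, x] w \<longrightarrow> x \<le> y) \<longleftrightarrow>
        noncrossing P \<and> (\<forall>b\<in>P. \<forall>b'\<in>P. nesting_le b b' \<longrightarrow> f b \<le> f b')"
      by (rule nested_iff_noncrossing_linear_extension[OF part inj len]) (rule val)
    then have "\<forall>x y. subseq [x, y, x] w \<longrightarrow> x \<le> y"
      using nc fD(3) by (rule iffD2[OF _ conjI])
    then show "x \<le> y" if "subseq [x, y, x] w" for x y using that by blast
  qed
  show "fiber w (f b) = b" if b: "b \<in> P" for b
  proof (intro equalityI subsetI)
    fix x assume "x \<in> fiber w (f b)"
    then have x: "x \<in> {1..n}" "w ! (x - 1) = f b" by (simp_all add: fiber_def len)
    then obtain b' where b': "b' \<in> P" "x \<in> b'" using blk by blast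
    then have "f b' = f b" using val[OF b'] x by simp
    then show "x \<in> b" using inj_onD[OF inj _ b'(1) b] b' by blast
  next
    fix x assume "x \<in> b"
    then show "x \<in> fiber w (f b)" using val[OF b] ran[OF b] by (simp add: fiber_def len)
  qed
qed

lemma fibers_label_word:
  assumes P: "P \<in> nc_partitions n" and f: "f \<in> linear_extensions P"
  shows "fibers_with_labels (label_word n (P, f)) = (P, f)"
proof -
  define w where "w = label_word n (P, f)"
  note fD = linear_extensionsD[OF f]
  have inj: "inj_on f P" using fD(2) by (simp add: bij_betw_def)
  note pr = label_word_properties[OF P f, folded w_def]
  have 1: "fiber w ` set w = P" unfolding pr(2) image_image using pr(3) by simp
  have injw: "inj_on (fiber w) (set w)" unfolding pr(2) by (rule inj_onI) (auto simp: pr(3))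
  have mem: "f b \<in> set w" if "b \<in> P" for b unfolding pr(2) using that by blast
  have "the_inv_into (set w) (fiber w) b = f b" if "b \<in> P" for b
    by (rule the_inv_into_f_eq[OF injw pr(3)[OF that] mem[OF that]])
  then have "restrict (the_inv_into (set w) (fiber w)) P = restrict f P" by (intro restrict_ext)
  also have "\<dots> = f" using fD(1) by (rule PiE_restrict)
  finally show ?thesis unfolding fibers_with_labels_def w_def[symmetric] 1 by simp
qed

lemma nested_word_of_fibers:
  assumes w: "w \<in> nested_words k n"
  shows "fibers_with_labels w \<in> Sigma (nc_partitions n) linear_extensions"
    "label_word n (fibers_with_labels w) = w"
proof -
  define P where "P = fiber w ` set w"
  define g where "g = the_inv_into (set w) (fiber w)"
  define f where "f = restrict g P"
  note len = nested_wordsD(1)[OF w] and setw = nested_wordsD(2)[OF w]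
  have ne: "fiber w c \<noteq> {}" if c: "c \<in> set w" for c
  proof -
    obtain i where "i < n" "w ! i = c" using c unfolding in_set_conv_nth len by blast
    then have "Suc i \<in> fiber w c" by (simp add: fiber_def len)
    then show ?thesis by blast
  qed
  have inj: "inj_on (fiber w) (set w)"
  proof (rule inj_onI)
    fix c d assume c: "c \<in> set w" and eq: "fiber w c = fiber w d"
    from ne[OF c] obtain x where x: "x \<in> fiber w c" by blast
    then have "x \<in> fiber w d" unfolding eq .
    with x have "w ! (x - 1) = c" "w ! (x - 1) = d" unfolding fiber_def by blast+
    then show "c = d" by (rule subst)
  qed
  have part: "partition_on {1..n} P"
  proof (rule partition_onI)
    show "\<Union>P = {1..n}"
    proof (intro equalityI subsetI)
      fix x assume x: "x \<in> {1..n}"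
      then have "x - 1 < length w" using len by auto
      then have "w ! (x - 1) \<in> set w" by simp
      moreover have "x \<in> fiber w (w ! (x - 1))" using x by (simp add: fiber_def len)
      ultimately show "x \<in> \<Union>P" unfolding P_def by blast
    qed (auto simp: P_def fiber_def len)
    show "{} \<notin> P" using ne by (auto simp: P_def)
    show "disjnt p q" if "p \<in> P" "q \<in> P" "p \<noteq> q" for p q
      using that by (auto simp: P_def fiber_def disjnt_def)
  qed
  \<comment> \<open>A linear extension takes values in \<open>{1..card P}\<close>, so the letters must be as many as the fibers.\<close>
  have bijf: "bij_betw (fiber w) (set w) P" using inj by (simp add: bij_betw_def P_def)
  have cardP: "card P = k" using bij_betw_same_card[OF bijf] setw by simp
  have "bij_betw g P {1..card P}"
    using bij_betw_the_inv_into[OF bijf] by (simp add: g_def setw cardP)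
  then have bij: "bij_betw f P {1..card P}"
    by (rule bij_betw_cong[THEN iffD1, rotated]) (simp add: f_def)
  have val: "w ! (x - 1) = f b" if b: "b \<in> P" and x: "x \<in> b" for b x
  proof -
    obtain c where c: "c \<in> set w" "b = fiber w c" using b unfolding P_def by blast
    have "f b = c" using b the_inv_into_f_f[OF inj c(1)] by (simp add: f_def g_def c(2))
    moreover have "w ! (x - 1) = c" using x unfolding c(2) fiber_def by blast
    ultimately show ?thesis by (simp only:)
  qed
  have injf: "inj_on f P" using bij by (simp add: bij_betw_def)
  have "\<forall>x y. subseq [x, y, x] w \<longrightarrow> x \<le> y" using nested_wordsD(3)[OF w] by (intro allI impI)
  moreover have "(\<forall>x y. subseq [x, y, x] w \<longrightarrow> x \<le> y) \<longleftrightarrow>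
      noncrossing P \<and> (\<forall>b\<in>P. \<forall>b'\<in>P. nesting_le b b' \<longrightarrow> f b \<le> f b')"
    by (rule nested_iff_noncrossing_linear_extension[OF part injf len]) (rule val)
  ultimately have order: "noncrossing P \<and> (\<forall>b\<in>P. \<forall>b'\<in>P. nesting_le b b' \<longrightarrow> f b \<le> f b')"
    by (rule iffD1[rotated])
  have ext: "f \<in> P \<rightarrow>\<^sub>E {1..card P}"
    using bij_betwE[OF bij] by (intro PiE_I) (simp_all add: f_def)
  have eq: "fibers_with_labels w = (P, f)"
    by (simp add: fibers_with_labels_def P_def f_def g_def)
  have "P \<in> nc_partitions n" "f \<in> linear_extensions P"
    unfolding nc_partitions_def linear_extensions_def using part bij order ext by blast+
  then show "fibers_with_labels w \<in> Sigma (nc_partitions n) linear_extensions"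
    unfolding eq by (rule SigmaI)
  show "label_word n (fibers_with_labels w) = w"
    unfolding eq
  proof (rule nth_equalityI)
    show "length (label_word n (P, f)) = length w" by (simp add: length_label_word len)
    fix i assume "i < length (label_word n (P, f))"
    then have "Suc i \<in> \<Union>P"
      unfolding partition_onD1[OF part, symmetric] by (simp add: length_label_word)
    then obtain b where b: "b \<in> P" "Suc i \<in> b" by blast
    show "label_word n (P, f) ! i = w ! i"
      using label_word_block(2)[OF part b] val[OF b] by simp
  qed
qed

lemma card_fiber: "card (fiber w c) = count_list w c"
proof -
  have "fiber w c = Suc ` {i. i < length w \<and> c = w ! i}"
  proof (intro equalityI subsetI)
    fix x assume "x \<in> fiber w c"
    then show "x \<in> Suc ` {i. i < length w \<and> c = w ! i}"
      by (intro image_eqI[of _ _ "x - 1"]) (auto simp: fiber_def)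
  qed (auto simp: fiber_def)
  then have "card (fiber w c) = card {i. i < length w \<and> c = w ! i}"
    by (simp add: card_image)
  then show ?thesis by (simp add: count_list_eq_length_filter length_filter_conv_card)
qed

lemma word_weight_label_word:
  assumes P: "P \<in> nc_partitions n" and f: "f \<in> linear_extensions P"
  shows "word_weight a (label_word n (P, f)) = (\<Prod>b\<in>P. a (card b))"
proof -
  note pr = label_word_properties[OF P f]
  have inj: "inj_on f P" using linear_extensionsD(2)[OF f] by (simp add: bij_betw_def)
  have "word_weight a (label_word n (P, f)) = (\<Prod>b\<in>P. a (card (fiber (label_word n (P, f)) (f b))))"
    unfolding word_weight_def pr(2) prod.reindex[OF inj] card_fiber by simp
  also have "\<dots> = (\<Prod>b\<in>P. a (card b))" by (intro prod.cong refl) (simp add: pr(3))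
  finally show ?thesis .
qed

text \<open>
  Spreading \<open>le(P)\<close> over the individual linear extensions turns the left-hand side into a sum over
  pairs, and these correspond to the words, with block sizes becoming letter multiplicities.
\<close>

lemma sum_nc_partitions_eq:
  fixes a :: "nat \<Rightarrow> 'k::field_char_0"
  shows "(\<Sum>P\<in>nc_partitions n. of_nat (card (linear_extensions P)) / fact (card P) * (\<Prod>b\<in>P. a (card b)))
    = (\<Sum>k\<le>n. total_weight a k n / fact k)"
proof -
  define S where "S = Sigma (nc_partitions n) linear_extensions"
  have finP: "finite P" if "P \<in> nc_partitions n" for P
    using that by (intro finite_elements[of "{1..n}"]) (auto simp: nc_partitions_def)
  have "(\<Sum>P\<in>nc_partitions n. of_nat (card (linear_extensions P)) / fact (card P) * (\<Prod>b\<in>P. a (card b)))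
      = (\<Sum>P\<in>nc_partitions n. \<Sum>f\<in>linear_extensions P. (\<Prod>b\<in>P. a (card b)) / fact (card P))"
    by simp
  also have "\<dots> = (\<Sum>(P, f)\<in>S. (\<Prod>b\<in>P. a (card b)) / fact (card P))"
    unfolding S_def by (rule sum.Sigma) (simp_all add: finite_nc_partitions finite_linear_extensions finP)
  also have "\<dots> = (\<Sum>w\<in>(\<Union>k\<le>n. nested_words k n). word_weight a w / fact (card (set w)))"
  proof (rule sum.reindex_bij_witness[of _ fibers_with_labels "label_word n"])
    fix s assume "s \<in> S"
    then obtain P f where s: "s = (P, f)" "P \<in> nc_partitions n" "f \<in> linear_extensions P"
      unfolding S_def by blast
    note pr = label_word_properties[OF s(2,3)]
    have "card P \<le> length (label_word n (P, f))"
      using card_length[of "label_word n (P, f)"] nested_wordsD(2)[OF pr(1)] by simp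
    then have "card P \<le> n" by (simp add: length_label_word)
    then show "label_word n s \<in> (\<Union>k\<le>n. nested_words k n)" using pr(1) s(1) by blast
    show "fibers_with_labels (label_word n s) = s" using fibers_label_word s by simp
    show "word_weight a (label_word n s) / fact (card (set (label_word n s)))
        = (case s of (P, f) \<Rightarrow> (\<Prod>b\<in>P. a (card b)) / fact (card P))"
      using word_weight_label_word[OF s(2,3)] nested_wordsD(2)[OF pr(1)] by (simp add: s(1))
  next
    fix w assume "w \<in> (\<Union>k\<le>n. nested_words k n)"
    then obtain k where "w \<in> nested_words k n" by blast
    from nested_word_of_fibers[OF this]
    show "label_word n (fibers_with_labels w) = w" "fibers_with_labels w \<in> S"
      by (simp_all add: S_def)
  qed
  also have "\<dots> = (\<Sum>k\<le>n. \<Sum>w\<in>nested_words k n. word_weight a w / fact (card (set w)))"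
  proof (rule sum.UNION_disjoint)
    show "\<forall>i\<in>{..n}. \<forall>j\<in>{..n}. i \<noteq> j \<longrightarrow> nested_words i n \<inter> nested_words j n = {}"
    proof (intro ballI impI)
      fix i j :: nat assume "i \<noteq> j"
      then have "{1..i} \<noteq> {1..j}" by (metis card_atLeastAtMost diff_Suc_1)
      then show "nested_words i n \<inter> nested_words j n = {}" using nested_wordsD(2) by blast
    qed
  qed (simp_all add: finite_nested_words)
  also have "\<dots> = (\<Sum>k\<le>n. total_weight a k n / fact k)"
    unfolding total_weight_def sum_divide_distrib
    by (intro sum.cong refl) (simp add: nested_wordsD(2))
  finally show ?thesis .
qed

section \<open>Convolution evaluated at the partitions into singletons\<close>

text \<open>
  The coproduct of a generator is a sum of tensor products of monomials, on which the form
  \<open>\<phi> \<otimes> \<mu>\<close> can be read off term by term.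
\<close>

lemma tensor_form_single_sum:
  assumes "finite I"
  shows "tensor_form \<phi> \<mu> (\<Sum>i\<in>I. Poly_Mapping.single (M i, M' i) 1)
    = (\<Sum>i\<in>I. \<phi> (Poly_Mapping.single (M i) 1) * \<mu> (Poly_Mapping.single (M' i) 1))"
proof -
  define F where "F p c = c * (\<phi> (Poly_Mapping.single (fst p) 1) * \<mu> (Poly_Mapping.single (snd p) 1))" for p c
  have form: "tensor_form \<phi> \<mu> t = (\<Sum>p\<in>Poly_Mapping.keys t. F p (Poly_Mapping.lookup t p))" for t
    by (simp add: tensor_form_def F_def case_prod_beta)
  have add: "tensor_form \<phi> \<mu> (s + t) = tensor_form \<phi> \<mu> s + tensor_form \<phi> \<mu> t" for s t
    unfolding form by (rule setsum_keys_plus_distrib) (simp_all add: F_def algebra_simps)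
  have zero: "tensor_form \<phi> \<mu> 0 = 0" by (simp add: form)
  have single: "tensor_form \<phi> \<mu> (Poly_Mapping.single (M i, M' i) 1)
      = \<phi> (Poly_Mapping.single (M i) 1) * \<mu> (Poly_Mapping.single (M' i) 1)" for i
    by (simp add: form F_def)
  show ?thesis
    using assms by (induction I rule: finite_induct) (simp_all add: zero single add)
qed

lemma prod_gen:
  "(\<Prod>C\<in>X. gen (g C)) = Poly_Mapping.single (\<Sum>C\<in>X. Poly_Mapping.single (g C) 1) 1"
  by (induction X rule: infinite_finite_induct) (simp_all add: gen_def mult_single)

lemma tensor_gen_prod:
  "tensor (gen q) (\<Prod>C\<in>X. gen (g C))
    = Poly_Mapping.single (Poly_Mapping.single q 1, \<Sum>C\<in>X. Poly_Mapping.single (g C) 1) (1::'k::comm_ring_1)"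
  unfolding prod_gen by (simp add: tensor_def gen_def)

lemma free_lift_gen:
  "free_lift \<iota> f (gen x :: ('x, 'k::comm_ring_1) free_alg) = \<iota> 1 * f x"
  by (simp add: free_lift_def gen_def)

lemma character_prod_gen:
  assumes "is_character \<chi>"
  shows "\<chi> (\<Prod>C\<in>X. gen (g C)) = (\<Prod>C\<in>X. \<chi> (gen (g C)))"
proof -
  have "\<chi> 1 = 1" using assms unfolding is_character_def by (metis single_one)
  moreover have "\<chi> (p * q) = \<chi> p * \<chi> q" for p q using assms by (simp add: is_character_def)
  ultimately show ?thesis by (induction X rule: infinite_finite_induct) simp_all
qed

lemma conv_gen:
  assumes "is_character \<mu>" "finite (Ec \<pi>)"
  shows "(\<phi> \<star> \<mu>) (gen \<pi>) = (\<Sum>r\<in>Ec \<pi>. \<phi> (gen (quotient_ncp \<pi> r)) * (\<Prod>C\<in>blocks \<pi> // r. \<mu> (gen (restrict_ncp C))))"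
proof -
  have "(\<phi> \<star> \<mu>) (gen \<pi>) = (\<Sum>r\<in>Ec \<pi>. \<phi> (gen (quotient_ncp \<pi> r)) * \<mu> (\<Prod>C\<in>blocks \<pi> // r. gen (restrict_ncp C)))"
    unfolding conv_def comp_def coprod_def free_lift_gen tensor_gen_prod single_one mult_1
      tensor_form_single_sum[OF assms(2)]
    unfolding prod_gen by (simp add: gen_def)
  then show ?thesis unfolding character_prod_gen[OF assms(1)] .
qed

lemma finite_Ec: "finite (blocks \<pi>) \<Longrightarrow> finite (Ec \<pi>)"
  by (rule finite_subset[of _ "Pow (blocks \<pi> \<times> blocks \<pi>)"]) (auto simp: Ec_def equiv_def)

lemma blocks_J: "n \<ge> 1 \<Longrightarrow> blocks (J n) = singletons n"
  by (simp add: J_def Abs_ncp_inverse singletons_NCP)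

lemma image_singleton_Union:
  assumes "C \<subseteq> singletons n"
  shows "(\<lambda>x. {x}) ` (\<Union>C) = C"
proof -
  have "\<exists>x. b = {x}" if "b \<in> C" for b using assms that unfolding singletons_def by blast
  then show ?thesis by fastforce
qed

lemma restrict_ncp_singletons:
  assumes "C \<subseteq> singletons n"
  shows "restrict_ncp C = J (card (\<Union>C))"
proof -
  have C: "C = (\<lambda>x. {x}) ` (\<Union>C)" by (rule image_singleton_Union[OF assms, symmetric])
  have "\<Union>C \<subseteq> {1..n}" using assms by (auto simp: singletons_def)
  then have "finite (\<Union>C)" by (rule finite_subset) simp
  have "std_blocks C = (\<lambda>b. rank_in (\<Union>C) ` b) ` (\<lambda>x. {x}) ` (\<Union>C)"
    unfolding std_blocks_def by (subst (2) C) (rule refl)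
  also have "\<dots> = (\<lambda>x. {x}) ` rank_in (\<Union>C) ` (\<Union>C)" by (simp add: image_image)
  also have "\<dots> = singletons (card (\<Union>C))"
    unfolding rank_in_image[OF \<open>finite (\<Union>C)\<close>] singletons_def ..
  finally show ?thesis by (simp add: restrict_ncp_def J_def)
qed

text \<open>
  The relation on the singletons whose classes, when united, are the blocks of \<open>P\<close>: the blocks of
  \<open>J n\<close> are the sets \<open>{x}\<close>, so a block \<open>b\<close> of \<open>P\<close> corresponds to the class of all \<open>{x}\<close> with
  \<open>x \<in> b\<close>.
\<close>

definition same_block :: "nat set set \<Rightarrow> (nat set \<times> nat set) set" where
  "same_block P = {(A, B). \<exists>C\<in>(`) (\<lambda>x. {x}) ` P. A \<in> C \<and> B \<in> C}"

lemma equiv_eq_same_class: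
  assumes "equiv A r"
  shows "r = {(x, y). \<exists>C\<in>A // r. x \<in> C \<and> y \<in> C}"
proof (intro equalityI subsetI)
  fix p assume p: "p \<in> r"
  obtain x y where xy: "p = (x, y)" by (cases p)
  have "x \<in> A" using p xy assms by (auto simp: equiv_def)
  then have "r `` {x} \<in> A // r" "x \<in> r `` {x}"
    by (rule quotientI, rule equiv_class_self[OF assms])
  then show "p \<in> {(x, y). \<exists>C\<in>A // r. x \<in> C \<and> y \<in> C}" using p xy by auto
next
  fix p assume "p \<in> {(x, y). \<exists>C\<in>A // r. x \<in> C \<and> y \<in> C}"
  then obtain x y C where "p = (x, y)" "C \<in> A // r" "x \<in> C" "y \<in> C" by blast
  then show "p \<in> r" using in_quotient_imp_in_rel[OF assms, of C x y] by simp
qed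

lemma merge_singletons:
  assumes r: "equiv (singletons n) r"
  shows "partition_on {1..n} (merge_blocks (singletons n) r)" "same_block (merge_blocks (singletons n) r) = r"
    "inj_on Union (singletons n // r)"
proof -
  define Q where "Q = singletons n // r"
  have Q: "partition_on (singletons n) Q" unfolding Q_def by (rule partition_on_quotient[OF r])
  have sub: "C \<subseteq> singletons n" if "C \<in> Q" for C using partition_onD1[OF Q] that by blast
  have rec: "(\<lambda>x. {x}) ` (\<Union>C) = C" if "C \<in> Q" for C
    by (rule image_singleton_Union[OF sub[OF that]])
  show "inj_on Union (singletons n // r)"
    unfolding Q_def[symmetric] by (rule inj_on_inverseI) (rule rec)
  have "(`) (\<lambda>x. {x}) ` Union ` Q = Q" unfolding image_image using rec by simp
  then show "same_block (merge_blocks (singletons n) r) = r"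
    using equiv_eq_same_class[OF r] unfolding merge_blocks_def same_block_def Q_def by simp
  show "partition_on {1..n} (merge_blocks (singletons n) r)"
    unfolding merge_blocks_def Q_def[symmetric]
  proof (rule partition_onI)
    have "\<Union>(Union ` Q) = \<Union>(\<Union>Q)" by blast
    also have "\<dots> = {1..n}" unfolding partition_onD1[OF Q, symmetric] by (simp add: singletons_def)
    finally show "\<Union>(Union ` Q) = {1..n}" .
    show "{} \<notin> Union ` Q"
    proof
      assume "{} \<in> Union ` Q"
      then obtain C where "C \<in> Q" "\<Union>C = {}" by auto
      then have "C = {}" using rec[OF \<open>C \<in> Q\<close>] by (metis image_empty)
      then show False using partition_onD3[OF Q] \<open>C \<in> Q\<close> by simp
    qed
    fix p q assume "p \<in> Union ` Q" "q \<in> Union ` Q" "p \<noteq> q"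
    then obtain C D where CD: "C \<in> Q" "D \<in> Q" "p = \<Union>C" "q = \<Union>D" "C \<noteq> D" by blast
    then have dis: "C \<inter> D = {}" using partition_onD2[OF Q] by (metis disjointD)
    have "x \<notin> q" if "x \<in> p" for x
    proof
      assume "x \<in> q"
      then have "{x} \<in> C" "{x} \<in> D" using that rec[OF CD(1)] rec[OF CD(2)] CD(3,4) by blast+
      then show False using dis by blast
    qed
    then show "disjnt p q" by (auto simp: disjnt_iff)
  qed
qed

lemma same_block_of_partition:
  assumes P: "partition_on {1..n} P"
  shows "equiv (singletons n) (same_block P)" "merge_blocks (singletons n) (same_block P) = P"
proof -
  define Q where "Q = (`) (\<lambda>x. {x}) ` P"
  have "Q - {{}} = Q" using partition_onD3[OF P] by (auto simp: Q_def)
  then have Q: "partition_on (singletons n) Q"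
    using partition_on_inj_image[OF P, of "\<lambda>x. {x}"] by (simp add: Q_def singletons_def)
  have eq: "same_block P = {(x, y). \<exists>C\<in>Q. x \<in> C \<and> y \<in> C}" by (simp add: same_block_def Q_def)
  show "equiv (singletons n) (same_block P)" unfolding eq by (rule equiv_partition_on[OF Q])
  have "singletons n // same_block P = Q" unfolding eq by (rule partition_on_eq_quotient[OF Q])
  then show "merge_blocks (singletons n) (same_block P) = P"
    by (simp add: merge_blocks_def Q_def image_image)
qed

lemma lambda0_gen:
  "lambda0 (gen \<pi>) = of_nat (card (linear_extensions (blocks \<pi>))) / fact (card (blocks \<pi>))"
  by (simp add: lambda0_def free_lift_gen le_ext_def linear_extensions_def)

text \<open>
  Merging singletons is a bijection from the equivalence relations in \<open>Ec (J n)\<close> to the noncrossing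
  partitions of \<open>{1..n}\<close>, and a class of \<open>m\<close> singletons restricts to \<open>J m\<close>.
\<close>

lemma conv_lambda0_J:
  fixes \<mu> :: "'k::field_char_0 ncp_alg \<Rightarrow> 'k"
  assumes \<mu>: "is_character \<mu>" and n: "n \<ge> 1"
  shows "(lambda0 \<star> \<mu>) (gen (J n)) = (\<Sum>P\<in>nc_partitions n.
    of_nat (card (linear_extensions P)) / fact (card P) * (\<Prod>b\<in>P. \<mu> (gen (J (card b)))))"
proof -
  have Ec: "Ec (J n) = {r. equiv (singletons n) r \<and> noncrossing (merge_blocks (singletons n) r)}"
    by (simp add: Ec_def blocks_J[OF n])
  have "finite (Ec (J n))" by (rule finite_Ec) (simp add: blocks_J[OF n] singletons_def)
  from conv_gen[OF \<mu> this, of lambda0] have "(lambda0 \<star> \<mu>) (gen (J n)) = (\<Sum>r\<in>Ec (J n).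
      lambda0 (gen (quotient_ncp (J n) r)) * (\<Prod>C\<in>singletons n // r. \<mu> (gen (restrict_ncp C))))"
    by (simp add: blocks_J[OF n])
  also have "\<dots> = (\<Sum>P\<in>nc_partitions n.
    of_nat (card (linear_extensions P)) / fact (card P) * (\<Prod>b\<in>P. \<mu> (gen (J (card b)))))"
  proof (rule sum.reindex_bij_witness[of _ same_block "merge_blocks (singletons n)"])
    fix r assume r: "r \<in> Ec (J n)"
    then have eq: "equiv (singletons n) r" by (simp add: Ec)
    show "same_block (merge_blocks (singletons n) r) = r" by (rule merge_singletons(2)[OF eq])
    show "merge_blocks (singletons n) r \<in> nc_partitions n"
      using merge_singletons(1)[OF eq] r by (simp add: nc_partitions_def Ec)
    have "blocks (quotient_ncp (J n) r) = merge_blocks (singletons n) r"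
      using Abs_ncp_inverse[OF merge_blocks_NCP[OF r]] by (simp add: quotient_ncp_def blocks_J[OF n])
    moreover have "(\<Prod>b\<in>merge_blocks (singletons n) r. \<mu> (gen (J (card b))))
        = (\<Prod>C\<in>singletons n // r. \<mu> (gen (restrict_ncp C)))"
      unfolding merge_blocks_def prod.reindex[OF merge_singletons(3)[OF eq]]
      by (intro prod.cong refl) (simp add: restrict_ncp_singletons[OF in_quotient_imp_subset[OF eq]])
    ultimately show "of_nat (card (linear_extensions (merge_blocks (singletons n) r)))
        / fact (card (merge_blocks (singletons n) r))
        * (\<Prod>b\<in>merge_blocks (singletons n) r. \<mu> (gen (J (card b))))
      = lambda0 (gen (quotient_ncp (J n) r)) * (\<Prod>C\<in>singletons n // r. \<mu> (gen (restrict_ncp C)))"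
      by (simp add: lambda0_gen)
  next
    fix P assume "P \<in> nc_partitions n"
    then have P: "partition_on {1..n} P" "noncrossing P" by (simp_all add: nc_partitions_def)
    show "merge_blocks (singletons n) (same_block P) = P" by (rule same_block_of_partition(2)[OF P(1)])
    show "same_block P \<in> Ec (J n)"
      using same_block_of_partition[OF P(1)] P(2) by (simp add: Ec)
  qed
  finally show ?thesis .
qed

lemma eps_delta_J:
  "n \<ge> 1 \<Longrightarrow> eps_delta (gen (J n) :: 'k::comm_ring_1 ncp_alg) = (if n = 1 then 1 else 0)"
  by (simp add: eps_delta_def free_lift_gen blocks_J singletons_def card_image)

lemma total_weight_exp_eq:
  fixes \<mu> :: "'k::field_char_0 ncp_alg \<Rightarrow> 'k"
  assumes "is_conv_inverse lambda0 \<mu>"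
  shows "(\<Sum>k\<le>n. total_weight (\<lambda>j. \<mu> (gen (J j))) k n / fact k) = (if n \<le> 1 then 1 else 0)"
proof (cases "n = 0")
  case False
  have "is_character \<mu>" "(lambda0 \<star> \<mu>) (gen (J n)) = eps_delta (gen (J n))"
    using assms by (simp_all add: is_conv_inverse_def)
  moreover have "n \<le> 1 \<longleftrightarrow> n = 1" using False by auto
  ultimately show ?thesis
    using conv_lambda0_J[of \<mu> n] eps_delta_J[of n, where 'k = 'k] sum_nc_partitions_eq[of "\<lambda>j. \<mu> (gen (J j))" n] False by simp
qed (simp add: total_weight_0)

section \<open>The inverse character and the generator\<close>

definition gen_series :: "(nat \<Rightarrow> 'k::field_char_0) \<Rightarrow> 'k fps" where
  "gen_series a = Abs_fps (\<lambda>m. if m \<le> 1 then 0 else a (m - 1))"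

lemma gen_series_nth:
  "gen_series a $ 0 = 0" "gen_series a $ 1 = 0" "j \<ge> 1 \<Longrightarrow> gen_series a $ Suc j = a j"
  by (simp_all add: gen_series_def)

text \<open>
  Both sides satisfy the same recursion in \<open>k\<close>: differentiating \<open>X\<^bsup>n-j+1\<^esup>\<close> produces the factor
  that counts the positions for a new run of length \<open>j\<close>.
\<close>

lemma vfield_gen_series_power_nth:
  "(vfield (gen_series a) ^^ k) fps_X $ 0 = 0"
  "(vfield (gen_series a) ^^ k) fps_X $ Suc n = total_weight a k n"
proof -
  define v where "v = gen_series a"
  show "(vfield (gen_series a) ^^ k) fps_X $ 0 = 0"
    by (cases k) (simp_all add: vfield_nth gen_series_nth)
  have "(vfield v ^^ k) fps_X $ Suc n = total_weight a k n"
  proof (induction k arbitrary: n)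
    case (Suc k)
    define U where "U = (vfield v ^^ k) fps_X"
    have U: "U $ Suc m = total_weight a k m" for m unfolding U_def by (rule Suc)
    have "(vfield v ^^ Suc k) fps_X $ Suc n
        = (\<Sum>i=0..Suc n. v $ i * (of_nat (Suc n - i + 1) * U $ (Suc n - i + 1)))"
      by (simp only: funpow.simps comp_apply vfield_nth U_def)
    also have "\<dots> = (\<Sum>i=Suc 1..Suc n. v $ i * (of_nat (Suc n - i + 1) * U $ (Suc n - i + 1)))"
    proof (rule sum.mono_neutral_right)
      show "\<forall>i\<in>{0..Suc n} - {Suc 1..Suc n}. v $ i * (of_nat (Suc n - i + 1) * U $ (Suc n - i + 1)) = 0"
      proof
        fix i assume "i \<in> {0..Suc n} - {Suc 1..Suc n}"
        then have "i = 0 \<or> i = 1" by auto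
        then show "v $ i * (of_nat (Suc n - i + 1) * U $ (Suc n - i + 1)) = 0"
          unfolding v_def using gen_series_nth(1,2)[of a] by (elim disjE) (simp_all only: mult_zero_left)
      qed
    qed simp_all
    also have "\<dots> = (\<Sum>j=1..n. v $ Suc j * (of_nat (n - j + 1) * U $ Suc (n - j)))"
      unfolding sum.shift_bounds_cl_Suc_ivl by simp
    also have "\<dots> = total_weight a (Suc k) n"
      unfolding total_weight_Suc
    proof (intro sum.cong refl)
      fix j assume "j \<in> {1..n}"
      then have "v $ Suc j = a j" unfolding v_def by (intro gen_series_nth) simp
      then show "v $ Suc j * (of_nat (n - j + 1) * U $ Suc (n - j))
          = a j * of_nat (n - j + 1) * total_weight a k (n - j)"
        unfolding U by (simp only: mult.assoc)
    qed
    finally show ?case .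
  qed (simp add: total_weight_0 fps_X_nth)
  then show "(vfield (gen_series a) ^^ k) fps_X $ Suc n = total_weight a k n" unfolding v_def .
qed

text \<open>
  The coefficient of \<open>X\<^bsup>n+1\<^esup>\<close> in the exponential is the sum that the inverse property computes at
  \<open>J n\<close>; for \<open>n = 0\<close>, where there is no \<open>J n\<close>, it comes from the empty word.
\<close>

lemma inverse_generates:
  fixes \<mu> :: "'k::field_char_0 ncp_alg \<Rightarrow> 'k"
  assumes "is_conv_inverse lambda0 \<mu>"
  shows "is_inf_generator (fps_X * (1 + fps_X)) (gen_series (\<lambda>j. \<mu> (gen (J j))))"
    (is "is_inf_generator _ (gen_series ?a)")
proof -
  have "exp_vfield (gen_series ?a) fps_X $ m = (fps_X * (1 + fps_X)) $ m" for m
  proof (cases m)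
    case 0
    then show ?thesis by (simp add: exp_vfield_def)
  next
    case (Suc n)
    have "exp_vfield (gen_series ?a) fps_X $ Suc n = (\<Sum>k\<le>Suc n. total_weight ?a k n / fact k)"
      unfolding exp_vfield_def divided_iterate_def
      by (simp add: vfield_gen_series_power_nth del: sum.atMost_Suc)
    also have "\<dots> = (\<Sum>k\<le>n. total_weight ?a k n / fact k)"
    proof -
      have False if "w \<in> nested_words (Suc n) n" for w
        using nested_wordsD(1,2)[OF that] card_length[of w] by simp
      then have "nested_words (Suc n) n = {}" by blast
      then show ?thesis by (simp add: total_weight_def)
    qed
    also have "\<dots> = (fps_X * (1 + fps_X)) $ Suc n"
      unfolding total_weight_exp_eq[OF assms] by (simp add: fps_X_nth)
    finally show ?thesis unfolding Suc .
  qed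
  then have "exp_vfield (gen_series ?a) fps_X = fps_X * (1 + fps_X)" by (rule fps_ext)
  then show ?thesis using gen_series_nth(1,2) unfolding is_inf_generator_iff by blast
qed

theorem proposition4p8:
  fixes lambda_NCP :: "'k::field_char_0 ncp_alg \<Rightarrow> 'k"
  assumes "is_conv_inverse lambda0 lambda_NCP"
  shows "(\<forall>n\<ge>1.
            fact (n - 1) * lambda_NCP (gen (J n))
              = fact (n - 1) * fps_nth (inf_generator (fps_X * (1 + fps_X))) (n + 1)
          \<or> fact (n - 1) * lambda_NCP (gen (J n))
              = - (fact (n - 1) * fps_nth (inf_generator (fps_X * (1 + fps_X))) (n + 1)))
       \<and> (\<forall>n\<ge>2.
            lambda_NCP (gen (J n))
              = - (1 / of_nat (n - 1)) *
                (\<Sum>i=1..n div 2. of_nat ((n - i + 1) choose (i + 1)) * lambda_NCP (gen (J (n - i)))))"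
proof -
  define v where "v = gen_series (\<lambda>n. lambda_NCP (gen (J n)))"
  have gen: "is_inf_generator (fps_X * (1 + fps_X)) v"
    unfolding v_def by (rule inverse_generates[OF assms])
  have "inf_generator (fps_X * (1 + fps_X)) = v"
    unfolding inf_generator_def using gen generator_unique by (blast intro: the_equality)
  moreover have v: "v $ (n + 1) = lambda_NCP (gen (J n))" if "n \<ge> 1" for n
    using gen_series_nth(3)[OF that] by (simp add: v_def)
  moreover have "lambda_NCP (gen (J n)) = - (1 / of_nat (n - 1)) *
      (\<Sum>i=1..n div 2. of_nat ((n - i + 1) choose (i + 1)) * lambda_NCP (gen (J (n - i))))"
    if n: "n \<ge> 2" for n
  proof -
    have "v $ (n - i + 1) = lambda_NCP (gen (J (n - i)))" if "i \<in> {1..n div 2}" for i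
      using that n by (intro v) auto
    then show ?thesis using generator_recurrence[OF gen n] v[of n] n by simp
  qed
  ultimately show ?thesis by simp
qed

end
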